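(* Consider the electric robo-taxi Markov decision process with state space $\mathcal S$ described in the context. For $s\in\mathcal S$ let $R^*(s)=\max_{\pi}R(\pi\mid s)$ be the optimal long-run average daily reward from initial state $s$, the maximum being over all (randomized, stationary) policies $\pi$. Let $\bar R$ be the optimal objective value of the fluid linear program described in the context. Then $$R^*(s)\le \bar R\qquad\text{for all } s\in\mathcal S .$$
   Context: **Primitives.** $V$ is a finite set of regions; $N\ge 1$ is the fleet size; $B$ is the battery range, with battery levels $b\in\{0,\dots,B\}$; $T\ge1$ is the number of time steps per day, $t\in[T]=\{1,\dots,T\}$, and days are $d=1,2,\dots$; time $T+1$ of day $d$ means time $1$ of day $d+1$. $\Delta$ is a finite set of charging rates; $n_v^\delta\in\mathbb N_{\ge0}$ is the number of rate-$\delta$ chargers in region $v$. Traveling from $u$ to $v$ consumes battery $b_{uv}\ge 0$; a trip from $u$ to $v$ started at time $t$ lasts $\tau_{uv}^t$ time steps. $L_c,L_p\ge 0$ are integers (connection and pickup patience times); a charging period lasts $J$ time steps, and a vehicle charging at rate $\delta$ gains $\delta J$ battery in it, capped at $B$. The quantities $\tau^t_{uv}$, $J$ are integers, $b_{uv}$ and $\delta J$ are nonnegative integers in battery units, $\min_{u,v,t}\tau_{uv}^t>L_p$, and $J>L_p$. The numbers of new requests $X_{uv}^{t,d}$ are independent Poisson variables with mean $\lambda_{uv}^t$. Rewards: $r^t_{f,uv}\ge 0$ (fulfilling a trip from $u$ to $v$), $r^t_{e,uv}\le 0$ (repositioning from $u$ to $v$), $r^t_{q,\delta}\le 0$ (charging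 at rate $\delta$). **Statuses.** Let $\hat\tau_v=\max_{u\in V,t\in[T]}\tau_{uv}^t$ and $H_v=\max\{\hat\tau_v+L_p,\,J-1\}$. - Vehicle statuses: $\mathcal C=\{(v,\eta,b): v\in V,\ 0\le\eta\le H_v,\ 0\le b\le B\}$ (region $v$ where the vehicle is or is heading, remaining time $\eta$ of its current task, battery $b$ at completion of the task). - Trip statuses: $\mathcal O=\{(u,v,\xi):u,v\in V,\ 0\le \xi\le L_c\}$ (origin, destination, time already waited for assignment). - Charger statuses: $\mathcal W=\{(v,\delta,j): v\in V,\ \delta\in\Delta,\ 0\le j\le J-1\}$ (region, rate, remaining time until available). **State.** A state is $s=(t,(s_c)_{c\in\mathcal C},(s_o)_{o\in\mathcal O},(s_w)_{w\in\mathcal W})$ with $t\in[T]$ and nonnegative integer counts such that $\sum_{c}s_c=N$, $\sum_{j=0}^{J-1}s_{(v,\delta,j)}=n_v^\delta$ for all $v,\delta$, and $s_o\le N(L_c+1)$ for all $o$. $\mathcal S$ is the (finite) set of states. **Actions.** An action in state $s$ is a vector of nonnegative integers $a=(f_{c,o},e_{c,v},q_{c,\delta},p_c)_{c\in\mathcal C,\,o\in\mathcal O,\,v\in V,\,\delta\in\Delta}$ (trip fulfilling, repositioning, charging, passing) such that - $f_{c,o}=0$ unless $c=(u,\eta,b)$ and $o=(u,v,\xi)$ share the same $u$, $\eta\le L_p$ and $b\ge b_{uv}$; and $\sum_c f_{c,o}\le s_o$ for all $o$; - $e_{c,v}=0$ unless $c=(u,0,b)$ with $u\ne v$ and $b\ge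 b_{uv}$; - $q_{c,\delta}=0$ unless $c=(u,0,b)$; and $\sum_{c=(v,\eta,b)\in\mathcal C}q_{c,\delta}\le s_{(v,\delta,0)}$ for all $v,\delta$; - $\sum_{o}f_{c,o}+\sum_{v}e_{c,v}+\sum_\delta q_{c,\delta}+p_c=s_c$ for all $c\in\mathcal C$. The set of feasible actions is $\mathcal A_s$. A policy $\pi$ assigns to each $s\in\mathcal S$ a probability distribution on $\mathcal A_s$. **Vehicle flow map.** For a vector $(f,e,q,p)=(f_{c,o},e_{c,v},q_{c,\delta},p_c)_{c\in\mathcal C,\,o\in\mathcal O,\,v\in V,\,\delta\in\Delta}$ (with integer or real entries), a time $t$, and a status $(v,\eta,b)\in\mathcal C$, put $$\begin{aligned}\Phi^t_{(v,\eta,b)}(f,e,q,p)=&\sum_{u\in V}\ \sum_{c'=(u,\eta',b')\in\mathcal C}\ \sum_{o=(u,v,\xi')\in\mathcal O} f_{c',o}\,\mathbf 1(\eta'+\tau_{uv}^t-1=\eta,\ b'-b_{uv}=b)\\&+\sum_{u\in V}\ \sum_{c'=(u,0,b')\in\mathcal C}e_{c',v}\,\mathbf 1(\tau_{uv}^t-1=\eta,\ b'-b_{uv}=b)\\&+\sum_{\delta\in\Delta}q_{(v,0,b-\delta J),\delta}\,\mathbf 1(\eta=J-1,\ b\ge\delta J)+\sum_{\delta\in\Delta}\ \sum_{b'>B-\delta J}q_{(v,0,b'),\delta}\,\mathbf 1(\eta=J-1,\ b=B)\\&+p_{(v,\eta,b)}\mathbf 1(\eta=0)+p_{(v,\eta+1,b)}\mathbf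 1(\eta<H_v).\end{aligned}$$ **Transitions.** From state $s$ at time $t$ of day $d$ under action $a=(f,e,q,p)$, the state at time $t+1$ (where time $T+1$ of day $d$ means time $1$ of day $d+1$) is: - vehicles: $s'_{(v,\eta,b)}=\Phi^t_{(v,\eta,b)}(a)$; - trips: $s'_{(u,v,0)}=\min\{X,\,N(L_c+1)\}$, where $X$ is the number of new requests from $u$ to $v$ at the new time step (Poisson with the mean $\lambda_{uv}$ of that new time step); and $s'_{(u,v,\xi)}=s_{(u,v,\xi-1)}-\sum_c f_{c,(u,v,\xi-1)}$ for $1\le\xi\le L_c$ (unassigned trips of status $\xi=L_c$ leave the system); - chargers (if $J\ge2$): $s'_{(v,\delta,J-1)}=\sum_{c=(v,0,b)}q_{c,\delta}$; $s'_{(v,\delta,j)}=s_{(v,\delta,j+1)}$ for $0<j<J-1$; $s'_{(v,\delta,0)}=s_{(v,\delta,1)}+s_{(v,\delta,0)}-\sum_{c=(v,0,b)}q_{c,\delta}$. (If $J=1$, all chargers are available at every step.) **Reward.** The reward of action $a$ at time $t$ is $$r^t(a)=\sum_{c\in\mathcal C}\sum_{u,v\in V}\sum_{\xi=0}^{L_c}r^t_{f,uv}f_{c,(u,v,\xi)}+\sum_{u,v\in V}\ \sum_{c=(u,\eta,b)\in\mathcal C}r^t_{e,uv}e_{c,v}+\sum_{c\in\mathcal C}\sum_{\delta\in\Delta}r^t_{q,\delta}q_{c,\delta}.$$ The long-run average daily reward of $\pi$ from initial state $s$ is $$R(\pi\mid s)=\lim_{D\to\infty}\frac1D\,\mathbb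 E_\pi\Big[\sum_{d=1}^D\sum_{t=1}^T r^t(a^{t,d})\,\Big|\,s\Big],$$ where $a^{t,d}$ is the action at time $t$ of day $d$ and the process starts in $s$ on day $1$ at the time component of $s$ (steps of day $1$ before the start contribute $0$). The limit exists since $\mathcal S$ is finite. **Fluid linear program.** Variables: real $\bar f^t_{c,o},\bar e^t_{c,v},\bar q^t_{c,\delta},\bar p^t_c$ for $c\in\mathcal C$, $o\in\mathcal O$, $v\in V$, $\delta\in\Delta$, $t\in[T]$; time superscripts are read modulo $T$ (periodic across days). Maximize $$N\sum_{t\in[T]}\Big[\sum_{c\in\mathcal C}\sum_{u,v\in V}\sum_{\xi=0}^{L_c}r^t_{f,uv}\bar f^t_{c,(u,v,\xi)}+\sum_{u,v\in V}\ \sum_{c=(u,\eta,b)\in\mathcal C}r^t_{e,uv}\bar e^t_{c,v}+\sum_{c\in\mathcal C}\sum_{\delta\in\Delta}r^t_{q,\delta}\bar q^t_{c,\delta}\Big]$$ subject to: 1. $\Phi^{t-1}_{c}(\bar f^{t-1},\bar e^{t-1},\bar q^{t-1},\bar p^{t-1})=\sum_{o}\bar f^t_{c,o}+\sum_{v'\in V}\bar e^t_{c,v'}+\sum_\delta\bar q^t_{c,\delta}+\bar p^t_c$ for all $c\in\mathcal C$, $t\in[T]$; 2. $\sum_{c=(u,\eta,b)\in\mathcal C}\ \sum_{\xi=0}^{L_c}\bar f^{\,t+\xi}_{c,(u,v,\xi)}\le\frac1N\lambda_{uv}^t$ for all $u,v\in V$, $t\in[T]$; 3. $\sum_{j=0}^{J-1}\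 \sum_{c=(v,0,b)\in\mathcal C}\bar q^{\,t-j}_{c,\delta}\le\frac1N n_v^\delta$ for all $v\in V$, $\delta\in\Delta$, $t\in[T]$; 4. $\bar f^t_{c,o}=0$ whenever $c=(u,\eta,b)$, $o=(u,v,\xi)$ and $b<b_{uv}$; 5. $\bar e^t_{c,v}=0$ whenever $c=(u,\eta,b)$ and $b<b_{uv}$; 6. $\sum_{c\in\mathcal C}\big[\sum_o\bar f^t_{c,o}+\sum_v\bar e^t_{c,v}+\sum_\delta\bar q^t_{c,\delta}+\bar p^t_c\big]=1$ for all $t\in[T]$; 7. all variables are nonnegative. *)

theory Defs
  imports "HOL-Probability.Probability"
begin

text \<open>Times of day are the numbers 1, ..., \<open>horizon\<close>.  In \<open>consumption\<close>, \<open>travel_time\<close>,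
  \<open>demand\<close>, \<open>fulfil_reward\<close> and \<open>reposition_reward\<close> the region arguments are origin and destination,
  in this order; the last argument of \<open>travel_time\<close>, \<open>demand\<close> and of the rewards is the time.\<close>

record 'v taxi_params =
  regions :: "'v set"
  fleet :: nat                                          (* N *)
  range_max :: nat                                      (* B *)
  horizon :: nat                                        (* T *)
  rates :: "real set"                                   (* Delta *)
  chargers :: "'v \<Rightarrow> real \<Rightarrow> nat"
  consumption :: "'v \<Rightarrow> 'v \<Rightarrow> nat"
  travel_time :: "'v \<Rightarrow> 'v \<Rightarrow> nat \<Rightarrow> nat"
  conn_patience :: nat                                  (* L_c *)
  pickup_patience :: nat                                (* L_p *)
  charge_period :: nat                                  (* J *)
  demand :: "'v \<Rightarrow> 'v \<Rightarrow> nat \<Rightarrow> real"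
  fulfil_reward :: "'v \<Rightarrow> 'v \<Rightarrow> nat \<Rightarrow> real"
  reposition_reward :: "'v \<Rightarrow> 'v \<Rightarrow> nat \<Rightarrow> real"
  charge_reward :: "real \<Rightarrow> nat \<Rightarrow> real"

locale robotaxi =
  fixes M :: "'v taxi_params"
  assumes finite_regions: "finite (regions M)"
    and fleet_ge_1: "fleet M \<ge> 1"
    and horizon_ge_1: "horizon M \<ge> 1"
    and finite_rates: "finite (rates M)"
    and charge_gain_nat: "\<delta> \<in> rates M \<Longrightarrow> \<delta> * real (charge_period M) \<in> \<nat>"
    and travel_time_gt_patience:
      "u \<in> regions M \<Longrightarrow> v \<in> regions M \<Longrightarrow> t \<in> {1..horizon M} \<Longrightarrow>
         pickup_patience M < travel_time M u v t"
    and charge_period_gt_patience: "pickup_patience M < charge_period M"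
    and demand_nonneg:
      "u \<in> regions M \<Longrightarrow> v \<in> regions M \<Longrightarrow> t \<in> {1..horizon M} \<Longrightarrow> 0 \<le> demand M u v t"
    and fulfil_reward_nonneg:
      "u \<in> regions M \<Longrightarrow> v \<in> regions M \<Longrightarrow> t \<in> {1..horizon M} \<Longrightarrow> 0 \<le> fulfil_reward M u v t"
    and reposition_reward_nonpos:
      "u \<in> regions M \<Longrightarrow> v \<in> regions M \<Longrightarrow> t \<in> {1..horizon M} \<Longrightarrow> reposition_reward M u v t \<le> 0"
    and charge_reward_nonpos:
      "\<delta> \<in> rates M \<Longrightarrow> t \<in> {1..horizon M} \<Longrightarrow> charge_reward M \<delta> t \<le> 0"

definition charge_gain :: "'v taxi_params \<Rightarrow> real \<Rightarrow> nat" where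
  "charge_gain M \<delta> = nat \<lfloor>\<delta> * real (charge_period M)\<rfloor>"

text \<open>Reduction of an arbitrary integer time to its representative in 1, ..., \<open>horizon\<close>.\<close>

definition day_time :: "'v taxi_params \<Rightarrow> int \<Rightarrow> nat" where
  "day_time M i = nat ((i - 1) mod int (horizon M)) + 1"

definition max_travel_time :: "'v taxi_params \<Rightarrow> 'v \<Rightarrow> nat" where
  "max_travel_time M v = Max {travel_time M u v t |u t. u \<in> regions M \<and> t \<in> {1..horizon M}}"

definition max_task :: "'v taxi_params \<Rightarrow> 'v \<Rightarrow> nat" where
  "max_task M v = max (max_travel_time M v + pickup_patience M) (charge_period M - 1)"

type_synonym 'v vehicle_status = "'v \<times> nat \<times> nat"   (* region, remaining time, battery *)
type_synonym 'v trip_status = "'v \<times> 'v \<times> nat"       (* origin, destination, waited time *)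
type_synonym 'v charger_status = "'v \<times> real \<times> nat"  (* region, rate, remaining time *)

definition vehicle_statuses :: "'v taxi_params \<Rightarrow> 'v vehicle_status set" where
  "vehicle_statuses M = {(v, \<eta>, b). v \<in> regions M \<and> \<eta> \<le> max_task M v \<and> b \<le> range_max M}"

definition trip_statuses :: "'v taxi_params \<Rightarrow> 'v trip_status set" where
  "trip_statuses M = {(u, v, \<xi>). u \<in> regions M \<and> v \<in> regions M \<and> \<xi> \<le> conn_patience M}"

definition charger_statuses :: "'v taxi_params \<Rightarrow> 'v charger_status set" where
  "charger_statuses M = {(v, \<delta>, j). v \<in> regions M \<and> \<delta> \<in> rates M \<and> j < charge_period M}"

record 'v state =
  time :: nat
  vehicles :: "'v vehicle_status \<Rightarrow> nat"
  trips :: "'v trip_status \<Rightarrow> nat"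
  avail :: "'v charger_status \<Rightarrow> nat"

text \<open>Vectors indexed by statuses are total functions; for states and actions they are required to
  vanish outside the index sets, so that functions and vectors correspond one to one.\<close>

definition states :: "'v taxi_params \<Rightarrow> 'v state set" where
  "states M = {s. time s \<in> {1..horizon M}
     \<and> (\<Sum>c\<in>vehicle_statuses M. vehicles s c) = fleet M
     \<and> (\<forall>v\<in>regions M. \<forall>\<delta>\<in>rates M. (\<Sum>j<charge_period M. avail s (v, \<delta>, j)) = chargers M v \<delta>)
     \<and> (\<forall>k\<in>trip_statuses M. trips s k \<le> fleet M * (conn_patience M + 1))
     \<and> (\<forall>c. c \<notin> vehicle_statuses M \<longrightarrow> vehicles s c = 0)
     \<and> (\<forall>k. k \<notin> trip_statuses M \<longrightarrow> trips s k = 0)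
     \<and> (\<forall>w. w \<notin> charger_statuses M \<longrightarrow> avail s w = 0)}"

text \<open>Vectors $(f,e,q,p)$, with natural entries for actions and real entries for the linear program.\<close>

record ('v, 'a) decision =
  fulfil :: "'v vehicle_status \<Rightarrow> 'v trip_status \<Rightarrow> 'a"
  reposition :: "'v vehicle_status \<Rightarrow> 'v \<Rightarrow> 'a"
  charge :: "'v vehicle_status \<Rightarrow> real \<Rightarrow> 'a"
  pass :: "'v vehicle_status \<Rightarrow> 'a"

type_synonym 'v action = "('v, nat) decision"

definition real_decision :: "('v, nat) decision \<Rightarrow> ('v, real) decision" where
  "real_decision a = \<lparr>fulfil = (\<lambda>c k. real (fulfil a c k)), reposition = (\<lambda>c v. real (reposition a c v)),
     charge = (\<lambda>c \<delta>. real (charge a c \<delta>)), pass = (\<lambda>c. real (pass a c))\<rparr>"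

definition decision_total :: "'v taxi_params \<Rightarrow> ('v, 'a::comm_semiring_1) decision \<Rightarrow> 'v vehicle_status \<Rightarrow> 'a" where
  "decision_total M a c = (\<Sum>k\<in>trip_statuses M. fulfil a c k) + (\<Sum>v\<in>regions M. reposition a c v)
     + (\<Sum>\<delta>\<in>rates M. charge a c \<delta>) + pass a c"

definition actions :: "'v taxi_params \<Rightarrow> 'v state \<Rightarrow> 'v action set" where
  "actions M s = {a.
     (\<forall>u \<eta> b u' v \<xi>. fulfil a (u, \<eta>, b) (u', v, \<xi>) \<noteq> 0 \<longrightarrow>
        (u, \<eta>, b) \<in> vehicle_statuses M \<and> (u', v, \<xi>) \<in> trip_statuses M \<and>
        u = u' \<and> \<eta> \<le> pickup_patience M \<and> b \<ge> consumption M u v)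
   \<and> (\<forall>k\<in>trip_statuses M. (\<Sum>c\<in>vehicle_statuses M. fulfil a c k) \<le> trips s k)
   \<and> (\<forall>u \<eta> b v. reposition a (u, \<eta>, b) v \<noteq> 0 \<longrightarrow>
        (u, \<eta>, b) \<in> vehicle_statuses M \<and> v \<in> regions M \<and> \<eta> = 0 \<and> u \<noteq> v \<and> b \<ge> consumption M u v)
   \<and> (\<forall>u \<eta> b \<delta>. charge a (u, \<eta>, b) \<delta> \<noteq> 0 \<longrightarrow>
        (u, \<eta>, b) \<in> vehicle_statuses M \<and> \<delta> \<in> rates M \<and> \<eta> = 0)
   \<and> (\<forall>v\<in>regions M. \<forall>\<delta>\<in>rates M.
        (\<Sum>\<eta>\<le>max_task M v. \<Sum>b\<le>range_max M. charge a (v, \<eta>, b) \<delta>) \<le> avail s (v, \<delta>, 0))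
   \<and> (\<forall>c. pass a c \<noteq> 0 \<longrightarrow> c \<in> vehicle_statuses M)
   \<and> (\<forall>c\<in>vehicle_statuses M. decision_total M a c = vehicles s c)}"

text \<open>The vehicle flow map.  Equations between times and batteries are arranged so that no
  truncated subtraction occurs.\<close>

fun flow :: "'v taxi_params \<Rightarrow> nat \<Rightarrow> ('v, 'a::comm_semiring_1) decision \<Rightarrow> 'v vehicle_status \<Rightarrow> 'a" where
  "flow M t x (v, \<eta>, b) =
     (\<Sum>u\<in>regions M. \<Sum>\<eta>'\<le>max_task M u. \<Sum>b'\<le>range_max M. \<Sum>\<xi>\<le>conn_patience M.
        if \<eta>' + travel_time M u v t = \<eta> + 1 \<and> b' = b + consumption M u v
        then fulfil x (u, \<eta>', b') (u, v, \<xi>) else 0)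
   + (\<Sum>u\<in>regions M. \<Sum>b'\<le>range_max M.
        if travel_time M u v t = \<eta> + 1 \<and> b' = b + consumption M u v
        then reposition x (u, 0, b') v else 0)
   + (\<Sum>\<delta>\<in>rates M. if \<eta> + 1 = charge_period M \<and> charge_gain M \<delta> \<le> b
        then charge x (v, 0, b - charge_gain M \<delta>) \<delta> else 0)
   + (\<Sum>\<delta>\<in>rates M. \<Sum>b' | b' \<le> range_max M \<and> range_max M < b' + charge_gain M \<delta>.
        if \<eta> + 1 = charge_period M \<and> b = range_max M then charge x (v, 0, b') \<delta> else 0)
   + (if \<eta> = 0 then pass x (v, \<eta>, b) else 0)
   + (if \<eta> < max_task M v then pass x (v, \<eta> + 1, b) else 0)"

definition reward :: "'v taxi_params \<Rightarrow> nat \<Rightarrow> ('v, real) decision \<Rightarrow> real" where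
  "reward M t x =
     (\<Sum>c\<in>vehicle_statuses M. \<Sum>u\<in>regions M. \<Sum>v\<in>regions M. \<Sum>\<xi>\<le>conn_patience M.
        fulfil_reward M u v t * fulfil x c (u, v, \<xi>))
   + (\<Sum>u\<in>regions M. \<Sum>v\<in>regions M. \<Sum>\<eta>\<le>max_task M u. \<Sum>b\<le>range_max M.
        reposition_reward M u v t * reposition x (u, \<eta>, b) v)
   + (\<Sum>c\<in>vehicle_statuses M. \<Sum>\<delta>\<in>rates M. charge_reward M \<delta> t * charge x c \<delta>)"

text \<open>\<open>next_state M s a X\<close> is the successor state when \<open>X (u, v)\<close> new requests from \<open>u\<close> to \<open>v\<close> arrive.
  In the case \<open>j = charge_period M - 1\<close> below, the period is at least 2.\<close>

definition next_state :: "'v taxi_params \<Rightarrow> 'v state \<Rightarrow> 'v action \<Rightarrow> ('v \<times> 'v \<Rightarrow> nat) \<Rightarrow> 'v state" where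
  "next_state M s a X = \<lparr>
     time = day_time M (int (time s) + 1),
     vehicles = (\<lambda>c. if c \<in> vehicle_statuses M then flow M (time s) a c else 0),
     trips = (\<lambda>(u, v, \<xi>). if (u, v, \<xi>) \<notin> trip_statuses M then 0
        else if \<xi> = 0 then min (X (u, v)) (fleet M * (conn_patience M + 1))
        else trips s (u, v, \<xi> - 1) - (\<Sum>c\<in>vehicle_statuses M. fulfil a c (u, v, \<xi> - 1))),
     avail = (\<lambda>(v, \<delta>, j). if (v, \<delta>, j) \<notin> charger_statuses M then 0
        else if charge_period M = 1 then chargers M v \<delta>
        else if j = charge_period M - 1 then (\<Sum>b\<le>range_max M. charge a (v, 0, b) \<delta>)
        else if j = 0 then
          avail s (v, \<delta>, 1) + avail s (v, \<delta>, 0) - (\<Sum>b\<le>range_max M. charge a (v, 0, b) \<delta>)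
        else avail s (v, \<delta>, j + 1))\<rparr>"

text \<open>The library's \<open>poisson_pmf\<close> requires a positive rate; mean 0 is the point mass at 0.\<close>

definition requests_pmf :: "real \<Rightarrow> nat pmf" where
  "requests_pmf m = (if m > 0 then poisson_pmf m else return_pmf 0)"

definition transition :: "'v taxi_params \<Rightarrow> 'v state \<Rightarrow> 'v action \<Rightarrow> 'v state pmf" where
  "transition M s a = map_pmf (next_state M s a)
     (Pi_pmf (regions M \<times> regions M) 0
        (\<lambda>(u, v). requests_pmf (demand M u v (day_time M (int (time s) + 1)))))"

type_synonym 'v policy = "'v state \<Rightarrow> 'v action pmf"

definition policies :: "'v taxi_params \<Rightarrow> 'v policy set" where
  "policies M = {\<pi>. \<forall>s\<in>states M. set_pmf (\<pi> s) \<subseteq> actions M s}"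

text \<open>Joint law of the first \<open>n\<close> state-action pairs from a given state.\<close>

fun trajectory :: "'v taxi_params \<Rightarrow> 'v policy \<Rightarrow> nat \<Rightarrow> 'v state \<Rightarrow> ('v state \<times> 'v action) list pmf" where
  "trajectory M \<pi> 0 s = return_pmf []"
| "trajectory M \<pi> (Suc n) s =
     bind_pmf (\<pi> s) (\<lambda>a. bind_pmf (transition M s a) (\<lambda>s'.
       map_pmf (\<lambda>h. (s, a) # h) (trajectory M \<pi> n s')))"

definition total_reward :: "'v taxi_params \<Rightarrow> ('v state \<times> 'v action) list \<Rightarrow> real" where
  "total_reward M h = (\<Sum>(s, a)\<leftarrow>h. reward M (time s) (real_decision a))"

text \<open>Starting at time \<open>time s\<close> of day 1, days 1, ..., \<open>D\<close> comprise
  \<open>D * horizon M + 1 - time s\<close> steps.\<close>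

definition average_reward :: "'v taxi_params \<Rightarrow> 'v policy \<Rightarrow> 'v state \<Rightarrow> real" where
  "average_reward M \<pi> s = lim (\<lambda>D. 1 / real D *
     measure_pmf.expectation (trajectory M \<pi> (D * horizon M + 1 - time s) s) (total_reward M))"

definition optimal_reward :: "'v taxi_params \<Rightarrow> 'v state \<Rightarrow> real" where
  "optimal_reward M s = (SUP \<pi>\<in>policies M. average_reward M \<pi> s)"

text \<open>The fluid linear program: \<open>x t\<close> holds the variables of time \<open>t\<close>, for \<open>t\<close> in 1, ..., \<open>horizon\<close>.\<close>

definition fluid_feasible :: "'v taxi_params \<Rightarrow> (nat \<Rightarrow> ('v, real) decision) set" where
  "fluid_feasible M = {x.
     (\<forall>t\<in>{1..horizon M}. \<forall>c\<in>vehicle_statuses M.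
        flow M (day_time M (int t - 1)) (x (day_time M (int t - 1))) c = decision_total M (x t) c)
   \<and> (\<forall>t\<in>{1..horizon M}. \<forall>u\<in>regions M. \<forall>v\<in>regions M.
        (\<Sum>\<eta>\<le>max_task M u. \<Sum>b\<le>range_max M. \<Sum>\<xi>\<le>conn_patience M.
           fulfil (x (day_time M (int t + int \<xi>))) (u, \<eta>, b) (u, v, \<xi>))
        \<le> 1 / real (fleet M) * demand M u v t)
   \<and> (\<forall>t\<in>{1..horizon M}. \<forall>v\<in>regions M. \<forall>\<delta>\<in>rates M.
        (\<Sum>j<charge_period M. \<Sum>b\<le>range_max M. charge (x (day_time M (int t - int j))) (v, 0, b) \<delta>)
        \<le> 1 / real (fleet M) * real (chargers M v \<delta>))
   \<and> (\<forall>t\<in>{1..horizon M}. \<forall>u \<eta> b v \<xi>.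
        (u, \<eta>, b) \<in> vehicle_statuses M \<longrightarrow> (u, v, \<xi>) \<in> trip_statuses M \<longrightarrow> b < consumption M u v \<longrightarrow>
        fulfil (x t) (u, \<eta>, b) (u, v, \<xi>) = 0)
   \<and> (\<forall>t\<in>{1..horizon M}. \<forall>u \<eta> b. \<forall>v\<in>regions M.
        (u, \<eta>, b) \<in> vehicle_statuses M \<longrightarrow> b < consumption M u v \<longrightarrow> reposition (x t) (u, \<eta>, b) v = 0)
   \<and> (\<forall>t\<in>{1..horizon M}. (\<Sum>c\<in>vehicle_statuses M. decision_total M (x t) c) = 1)
   \<and> (\<forall>t\<in>{1..horizon M}. \<forall>c\<in>vehicle_statuses M.
        (\<forall>k\<in>trip_statuses M. 0 \<le> fulfil (x t) c k) \<and> (\<forall>v\<in>regions M. 0 \<le> reposition (x t) c v) \<and>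
        (\<forall>\<delta>\<in>rates M. 0 \<le> charge (x t) c \<delta>) \<and> 0 \<le> pass (x t) c)}"

definition fluid_objective :: "'v taxi_params \<Rightarrow> (nat \<Rightarrow> ('v, real) decision) \<Rightarrow> real" where
  "fluid_objective M x = real (fleet M) * (\<Sum>t=1..horizon M. reward M t (x t))"

definition fluid_value :: "'v taxi_params \<Rightarrow> real" where
  "fluid_value M = (SUP x\<in>fluid_feasible M. fluid_objective M x)"

end

theory Submission
  imports Defs
begin

text \<open>Cesaro means of a finite Markov chain converge, so the state process of a policy \<open>\<pi>\<close> started in \<open>s\<close> has
  a limiting occupation measure \<open>\<mu>\<close>, which is invariant, and the average reward is the mean of the
  one-step reward under \<open>\<mu>\<close>, up to the factor \<open>horizon M\<close>. Averaging the actions under \<open>\<mu>\<close> separately for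
  each time of the day and dividing by the fleet size gives a point of the fluid linear program with the
  same objective value: its constraints are linear identities or inequalities that hold for the stationary
  means by invariance of \<open>\<mu>\<close>.\<close>

subsection \<open>Cesaro means of finite Markov chains\<close>

text \<open>The clock is part of the state, so the chain is periodic whenever a day has several
  steps; the law of the state need not converge, only its Cesaro means do. Convergence along a
  subsequence would not suffice either: \<open>average_reward\<close> is defined by
  \<open>lim\<close>, whose value says nothing about a divergent sequence. Hence the full mean
  ergodic theorem.

  The constraints on trips and chargers join decisions made at several times of day. They still
  reduce to means at single times: waiting trips and busy chargers are carried as counts in the
  state, and invariance of \<mu> moves such a count from one time to the next. Slack enters through
  the cap on arriving requests, unserved trips and idle chargers; the reward is transferred exactly.

  The comparison is between suprema of sets of reals, so it also takes a policy to exist and the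
  objective to be bounded above on the feasible set.\<close>

lemma finite_pointwise_convergent_subsequence:
  fixes a :: "nat \<Rightarrow> 's \<Rightarrow> real"
  assumes "finite S" and "\<And>n s. s \<in> S \<Longrightarrow> \<bar>a n s\<bar> \<le> C"
  shows "\<exists>g r. strict_mono (r :: nat \<Rightarrow> nat) \<and> (\<forall>s\<in>S. (\<lambda>n. a (r n) s) \<longlonglongrightarrow> g s)"
  using assms
proof (induction S)
  case empty
  show ?case by (auto intro: exI[of _ id] simp: strict_mono_def)
next
  case (insert x S)
  then obtain g r where r: "strict_mono (r :: nat \<Rightarrow> nat)" and g: "\<forall>s\<in>S. (\<lambda>n. a (r n) s) \<longlonglongrightarrow> g s"
    by auto
  have "bounded (range (\<lambda>n. a (r n) x))"
    using insert.prems[of x] by (auto simp: bounded_iff intro!: exI[of _ C])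
  then obtain l q where q: "strict_mono q" and l: "((\<lambda>n. a (r n) x) \<circ> q) \<longlonglongrightarrow> l"
    using bounded_imp_convergent_subsequence by blast
  \<comment> \<open>\<open>q\<close> is chosen for the coordinate \<open>x\<close> alone; thinning
    \<open>r\<close> by it keeps the limits already obtained on the other coordinates.\<close>
  have "(\<lambda>n. a ((r \<circ> q) n) s) \<longlonglongrightarrow> (g(x := l)) s" if "s \<in> insert x S" for s
  proof (cases "s = x")
    case True
    then show ?thesis using l by (simp add: o_def)
  next
    case False
    then show ?thesis using LIMSEQ_subseq_LIMSEQ[OF bspec[OF g, of s] q] that by (simp add: o_def)
  qed
  then show ?case using strict_mono_o[OF r q] by blast
qed

locale finite_markov =
  fixes S :: "'s set" and K :: "'s \<Rightarrow> 's pmf"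
  assumes finite_S: "finite S"
    and closed_S: "s \<in> S \<Longrightarrow> set_pmf (K s) \<subseteq> S"
begin

text \<open>The transition operator on functions: \<open>(step ^^ k) f s\<close> is the mean of
  \<open>f\<close> after \<open>k\<close> steps from a state \<open>s\<close> of \<open>S\<close>.
  As a finite sum over \<open>S\<close> it is linear at every \<open>s\<close>, without membership
  or integrability conditions.\<close>

definition step :: "('s \<Rightarrow> real) \<Rightarrow> 's \<Rightarrow> real" where
  "step f s = (\<Sum>s'\<in>S. pmf (K s) s' * f s')"

definition cesaro :: "nat \<Rightarrow> ('s \<Rightarrow> real) \<Rightarrow> 's \<Rightarrow> real" where
  "cesaro n f s = (\<Sum>k<n. (step ^^ k) f s) / real n"

lemma sum_pmf_K: "s \<in> S \<Longrightarrow> (\<Sum>s'\<in>S. pmf (K s) s') = 1"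
  by (rule sum_pmf_eq_1[OF finite_S closed_S])

lemma step_expectation: "s \<in> S \<Longrightarrow> step f s = measure_pmf.expectation (K s) f"
  unfolding step_def using closed_S[of s]
  by (subst integral_measure_pmf_real[OF finite_S]) (auto simp: mult.commute)

lemma step_cong: "(\<And>s. s \<in> S \<Longrightarrow> f s = g s) \<Longrightarrow> step f = step g"
  by (auto simp: step_def fun_eq_iff intro!: sum.cong)

lemma step_sum: "step (\<lambda>s. \<Sum>i\<in>I. c i * f i s) s = (\<Sum>i\<in>I. c i * step (f i) s)"
  unfolding step_def sum_distrib_left
  by (subst sum.swap) (auto intro!: sum.cong simp: algebra_simps)

lemma step_diff: "step (\<lambda>s. f s - g s) s = step f s - step g s"
  by (simp add: step_def algebra_simps sum_subtractf)

lemma funpow_step_sum: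
  "(step ^^ k) (\<lambda>s. \<Sum>i\<in>I. c i * f i s) s = (\<Sum>i\<in>I. c i * (step ^^ k) (f i) s)"
proof (induction k arbitrary: s)
  case (Suc k)
  then have "(step ^^ k) (\<lambda>s. \<Sum>i\<in>I. c i * f i s) = (\<lambda>s. \<Sum>i\<in>I. c i * (step ^^ k) (f i) s)"
    by auto
  then show ?case by (simp add: step_sum)
qed simp

lemma funpow_step_diff: "(step ^^ k) (\<lambda>s. f s - g s) s = (step ^^ k) f s - (step ^^ k) g s"
proof (induction k arbitrary: s)
  case (Suc k)
  then have "(step ^^ k) (\<lambda>s. f s - g s) = (\<lambda>s. (step ^^ k) f s - (step ^^ k) g s)"
    by auto
  then show ?case by (simp add: step_diff)
qed simp

lemma funpow_step_cong:
  assumes "\<And>s. s \<in> S \<Longrightarrow> f s = g s" "s \<in> S"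
  shows "(step ^^ k) f s = (step ^^ k) g s"
  using assms step_cong[of f g] by (cases k) (auto simp: funpow_Suc_right simp del: funpow.simps)

lemma step_const: "s \<in> S \<Longrightarrow> step (\<lambda>_. c) s = c"
  by (simp add: step_def sum_pmf_K flip: sum_distrib_right)

lemma step_bound:
  assumes "\<And>s. s \<in> S \<Longrightarrow> \<bar>f s\<bar> \<le> C" "s \<in> S"
  shows "\<bar>step f s\<bar> \<le> C"
proof -
  have "\<bar>step f s\<bar> \<le> (\<Sum>s'\<in>S. pmf (K s) s' * \<bar>f s'\<bar>)"
    unfolding step_def by (rule order_trans[OF sum_abs]) (simp add: abs_mult)
  also have "\<dots> \<le> (\<Sum>s'\<in>S. pmf (K s) s' * C)"
    by (intro sum_mono mult_left_mono assms) auto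
  also have "\<dots> = C"
    using assms(2) by (simp add: sum_pmf_K flip: sum_distrib_right)
  finally show ?thesis .
qed

lemma funpow_step_bound:
  assumes "\<And>s. s \<in> S \<Longrightarrow> \<bar>f s\<bar> \<le> C" "s \<in> S"
  shows "\<bar>(step ^^ k) f s\<bar> \<le> C"
  using assms(2)
proof (induction k arbitrary: s)
  case (Suc k)
  then show ?case using step_bound[of "(step ^^ k) f"] by auto
qed (use assms in auto)

lemma funpow_step_fixed:
  assumes "\<And>s. s \<in> S \<Longrightarrow> step g s = g s" "s \<in> S"
  shows "(step ^^ k) g s = g s"
  using assms(2)
proof (induction k arbitrary: s)
  case (Suc k)
  then show ?case using step_cong[of "(step ^^ k) g" g] assms(1) by simp
qed simp

lemma bounded_on_S: obtains C where "0 \<le> C" "\<And>s. s \<in> S \<Longrightarrow> \<bar>f s\<bar> \<le> (C::real)"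
proof
  show "0 \<le> (\<Sum>s\<in>S. \<bar>f s\<bar>)" by (simp add: sum_nonneg)
  show "\<bar>f s\<bar> \<le> (\<Sum>s\<in>S. \<bar>f s\<bar>)" if "s \<in> S" for s
    using that finite_S by (intro member_le_sum) auto
qed

lemma cesaro_bound:
  assumes "\<And>s. s \<in> S \<Longrightarrow> \<bar>f s\<bar> \<le> C" "s \<in> S" "0 \<le> C"
  shows "\<bar>cesaro n f s\<bar> \<le> C"
proof (cases "n = 0")
  case False
  have "\<bar>\<Sum>k<n. (step ^^ k) f s\<bar> \<le> (\<Sum>k<n. C)"
    by (rule order_trans[OF sum_abs sum_mono]) (use funpow_step_bound assms in auto)
  then show ?thesis using False by (simp add: cesaro_def field_simps)
qed (use assms in \<open>simp add: cesaro_def\<close>)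

text \<open>The two sums telescope to their end terms. This is the source of every
  \<open>1/n\<close> bound below and of the invariance of limits.\<close>

lemma cesaro_step_diff: "cesaro n (step f) s - cesaro n f s = ((step ^^ n) f s - f s) / real n"
proof -
  have "(\<Sum>k<n. (step ^^ k) (step f) s) - (\<Sum>k<n. (step ^^ k) f s)
      = (\<Sum>k<n. (step ^^ Suc k) f s - (step ^^ k) f s)"
    by (simp add: sum_subtractf funpow_swap1)
  also have "\<dots> = (step ^^ n) f s - f s"
    by (subst sum_lessThan_telescope) simp
  finally show ?thesis by (simp add: cesaro_def flip: diff_divide_distrib)
qed

lemma cesaro_diff: "cesaro n (\<lambda>s. f s - g s) s = cesaro n f s - cesaro n g s"
  by (simp add: cesaro_def funpow_step_diff sum_subtractf diff_divide_distrib)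

text \<open>By \<open>cesaro_step_diff\<close>, each further application of \<open>step\<close>
  moves the mean by at most \<open>2 * C / real n\<close>, since \<open>step\<close> preserves the
  bound \<open>C\<close>; the \<open>k\<close> contributions add up.\<close>

lemma cesaro_funpow_diff_bound:
  assumes f: "\<And>s. s \<in> S \<Longrightarrow> \<bar>f s\<bar> \<le> C" and s: "s \<in> S" and "0 \<le> C"
  shows "\<bar>cesaro n ((step ^^ k) f) s - cesaro n f s\<bar> \<le> 2 * real k * C / real n"
proof (induction k)
  case (Suc k)
  have "\<bar>(step ^^ n) ((step ^^ k) f) s - (step ^^ k) f s\<bar> \<le> C + C"
    using funpow_step_bound[of f C s "n + k"] funpow_step_bound[of f C s k] f s
    by (fastforce simp: funpow_add)
  then have "\<bar>cesaro n (step ((step ^^ k) f)) s - cesaro n ((step ^^ k) f) s\<bar> \<le> 2 * C / real n"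
    by (simp add: cesaro_step_diff divide_right_mono)
  then show ?case
    using Suc.IH by (simp add: algebra_simps add_divide_distrib)
qed simp

text \<open>The inner mean averages the shifted functions \<open>(step ^^ k) f\<close> with
  \<open>k < m\<close>, and each shift changes the outer mean by at most the stated amount. For
  fixed \<open>m\<close> and growing \<open>n\<close> the inner averaging becomes invisible.\<close>

lemma cesaro_cesaro_diff_bound:
  assumes f: "\<And>s. s \<in> S \<Longrightarrow> \<bar>f s\<bar> \<le> C" and s: "s \<in> S" and "0 \<le> C" "0 < m"
  shows "\<bar>cesaro n (cesaro m f) s - cesaro n f s\<bar> \<le> 2 * real m * C / real n"
proof -
  have "cesaro m f = (\<lambda>s. \<Sum>k<m. 1 / real m * (step ^^ k) f s)"
    by (auto simp: cesaro_def sum_divide_distrib)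
  then have "cesaro n (cesaro m f) s = (\<Sum>j<n. \<Sum>k<m. 1 / real m * (step ^^ j) ((step ^^ k) f) s) / real n"
    by (simp only: cesaro_def[of n] funpow_step_sum)
  also have "\<dots> = (\<Sum>k<m. 1 / real m * cesaro n ((step ^^ k) f) s)"
    by (subst sum.swap) (simp add: cesaro_def[of n] sum_divide_distrib sum_distrib_left)
  finally have "cesaro n (cesaro m f) s - cesaro n f s
      = (\<Sum>k<m. 1 / real m * (cesaro n ((step ^^ k) f) s - cesaro n f s))"
    using \<open>0 < m\<close> by (simp add: sum_subtractf diff_divide_distrib sum_divide_distrib flip: sum_divide_distrib)
  also have "\<bar>\<dots>\<bar> \<le> (\<Sum>k<m. 1 / real m * (2 * real m * C / real n))"
  proof (rule order_trans[OF sum_abs sum_mono])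
    fix k assume "k \<in> {..<m}"
    then have "2 * real k * C / real n \<le> 2 * real m * C / real n"
      using \<open>0 \<le> C\<close> by (intro divide_right_mono mult_right_mono) auto
    then have "\<bar>cesaro n ((step ^^ k) f) s - cesaro n f s\<bar> \<le> 2 * real m * C / real n"
      by (rule order_trans[OF cesaro_funpow_diff_bound, rotated -1]) (use f s \<open>0 \<le> C\<close> in auto)
    then show "\<bar>1 / real m * (cesaro n ((step ^^ k) f) s - cesaro n f s)\<bar>
        \<le> 1 / real m * (2 * real m * C / real n)"
      unfolding abs_mult by (intro mult_mono) auto
  qed
  also have "\<dots> = 2 * real m * C / real n"
    using \<open>0 < m\<close> by simp
  finally show ?thesis .
qed

lemma cesaro_step_diff_tendsto:
  assumes "s \<in> S"
  shows "(\<lambda>n. cesaro n (step f) s - cesaro n f s) \<longlonglongrightarrow> 0"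
proof -
  obtain C where C: "0 \<le> C" "\<And>s. s \<in> S \<Longrightarrow> \<bar>f s\<bar> \<le> C" using bounded_on_S by blast
  have "\<bar>(step ^^ n) f s - f s\<bar> \<le> C + C" for n
    using funpow_step_bound[of f C s n] C(2)[of s] C(2) assms by fastforce
  then have *: "norm (cesaro n (step f) s - cesaro n f s) \<le> (C + C) / real n" for n
    by (simp add: cesaro_step_diff divide_right_mono)
  have "(\<lambda>n. (C + C) / real n) \<longlonglongrightarrow> 0"
    by (intro tendsto_divide_0[OF tendsto_const] filterlim_at_top_imp_at_infinity filterlim_real_sequentially)
  then show ?thesis
    by (rule Lim_null_comparison[OF always_eventually, rotated]) (use * in auto)
qed

lemma step_cesaro: "step (cesaro n f) s = cesaro n (step f) s"
proof -
  have "cesaro n f = (\<lambda>s. \<Sum>k<n. 1 / real n * (step ^^ k) f s)"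
    by (auto simp: cesaro_def sum_divide_distrib)
  then have "step (cesaro n f) s = (\<Sum>k<n. 1 / real n * step ((step ^^ k) f) s)"
    by (simp only: step_sum)
  then show ?thesis by (simp add: cesaro_def sum_divide_distrib funpow_swap1)
qed

text \<open>Mean ergodic theorem: a subsequential limit \<open>g\<close> of the Cesaro means of \<open>f\<close> is invariant, hence
  \<open>cesaro n f - g\<close> is, up to \<open>O(1/n)\<close>, the mean of \<open>cesaro m f - g\<close>, which is small for suitable \<open>m\<close>.\<close>

lemma cesaro_convergent:
  assumes "s \<in> S"
  shows "convergent (\<lambda>n. cesaro n f s)"
proof -
  obtain C where C: "0 \<le> C" "\<And>s. s \<in> S \<Longrightarrow> \<bar>f s\<bar> \<le> C" using bounded_on_S by blast
  \<comment> \<open>\<open>cesaro_bound\<close> bounds the means uniformly in \<open>n\<close>, so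
    one subsequence serves all states at once.\<close>
  obtain g r where r: "strict_mono (r :: nat \<Rightarrow> nat)"
    and g: "\<And>s. s \<in> S \<Longrightarrow> (\<lambda>n. cesaro (r n) f s) \<longlonglongrightarrow> g s"
    using finite_pointwise_convergent_subsequence[OF finite_S, of "\<lambda>n. cesaro n f" C]
      cesaro_bound[of f C] C by blast
  have fixed: "step g s = g s" if s: "s \<in> S" for s
  proof -
    have "(\<lambda>n. step (cesaro (r n) f) s) \<longlonglongrightarrow> step g s"
      unfolding step_def by (intro tendsto_intros g)
    moreover have "(\<lambda>n. step (cesaro (r n) f) s - cesaro (r n) f s) \<longlonglongrightarrow> 0"
      using LIMSEQ_subseq_LIMSEQ[OF cesaro_step_diff_tendsto[OF s] r] by (simp add: o_def step_cesaro)
    ultimately have "(\<lambda>n. cesaro (r n) f s) \<longlonglongrightarrow> step g s"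
      using tendsto_diff by fastforce
    then show ?thesis using g[OF s] LIMSEQ_unique by blast
  qed
  have "(\<lambda>n. cesaro n f s) \<longlonglongrightarrow> g s"
  proof (rule LIMSEQ_I)
    fix e :: real assume "0 < e"
    have "\<forall>\<^sub>F n in sequentially. \<forall>s\<in>S. dist (cesaro (r n) f s) (g s) < e / 2"
      using tendstoD[OF g, of _ "e / 2"] \<open>0 < e\<close> finite_S by (auto intro!: eventually_ball_finite)
    then obtain n0 where n0: "\<And>n s. n \<ge> n0 \<Longrightarrow> s \<in> S \<Longrightarrow> dist (cesaro (r n) f s) (g s) < e / 2"
      unfolding eventually_sequentially by blast
    \<comment> \<open>The index is \<open>Suc n0\<close> rather than \<open>n0\<close> to have
      \<open>m\<close> positive: a strictly increasing \<open>r\<close> satisfies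
      \<open>k \<le> r k\<close>.\<close>
    define m where "m = r (Suc n0)"
    have "Suc n0 \<le> m" unfolding m_def by (rule seq_suble[OF r])
    then have "0 < m" by simp
    have m: "\<bar>cesaro m f s - g s\<bar> \<le> e / 2" if "s \<in> S" for s
      using n0[of "Suc n0" s] that by (auto simp: m_def dist_real_def)
    obtain n1 where n1: "2 * real m * C / (e / 2) < real n1" using reals_Archimedean2 by blast
    show "\<exists>no. \<forall>n\<ge>no. norm (cesaro n f s - g s) < e"
    proof (intro exI allI impI)
      fix n assume n: "max 1 n1 \<le> n"
      have "cesaro n g s = g s"
        using n funpow_step_fixed[OF fixed assms] by (simp add: cesaro_def)
      then have "\<bar>cesaro n (cesaro m f) s - g s\<bar> \<le> e / 2"
        using cesaro_bound[of "\<lambda>s. cesaro m f s - g s" "e / 2" s n] m assms \<open>0 < e\<close>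
        by (simp add: cesaro_diff)
      moreover have "\<bar>cesaro n (cesaro m f) s - cesaro n f s\<bar> \<le> 2 * real m * C / real n"
        by (rule cesaro_cesaro_diff_bound) (use C assms \<open>0 < m\<close> in auto)
      moreover have "2 * real m * C / real n < e / 2"
      proof -
        have "2 * real m * C / (e / 2) < real n" using n1 n by linarith
        then show ?thesis using \<open>0 < e\<close> n by (simp add: field_simps)
      qed
      ultimately show "norm (cesaro n f s - g s) < e" unfolding real_norm_def by linarith
    qed
  qed
  then show ?thesis by (auto simp: convergent_def)
qed

lemma cesaro_sum: "cesaro n (\<lambda>s. \<Sum>i\<in>I. c i * f i s) s = (\<Sum>i\<in>I. c i * cesaro n (f i) s)"
  unfolding cesaro_def funpow_step_sum
  by (subst sum.swap) (simp add: sum_divide_distrib sum_distrib_left)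

lemma cesaro_cong: "(\<And>s. s \<in> S \<Longrightarrow> f s = g s) \<Longrightarrow> s \<in> S \<Longrightarrow> cesaro n f s = cesaro n g s"
  by (simp add: cesaro_def funpow_step_cong[of f g])

lemma funpow_step_nonneg:
  assumes "\<And>s. s \<in> S \<Longrightarrow> 0 \<le> f s" "s \<in> S"
  shows "0 \<le> (step ^^ k) f s"
  using assms(2)
proof (induction k arbitrary: s)
  case (Suc k)
  then show ?case by (auto simp: step_def intro!: sum_nonneg)
qed (use assms in auto)

text \<open>\<mu> collects the limiting frequencies of visits to each state, which depend on
  \<open>s0\<close> because there may be several recurrent classes. Convergence for the point
  indicators gives it for every \<open>f\<close> by linearity, and invariance is
  \<open>cesaro_step_diff_tendsto\<close> in the limit.\<close>

lemma exists_limiting_occupation: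
  assumes s0: "s0 \<in> S"
  shows "\<exists>\<mu>. (\<forall>s\<in>S. 0 \<le> \<mu> s) \<and> (\<Sum>s\<in>S. \<mu> s) = 1
    \<and> (\<forall>f. (\<Sum>s\<in>S. \<mu> s * step f s) = (\<Sum>s\<in>S. \<mu> s * f s))
    \<and> (\<forall>f. (\<lambda>n. cesaro n f s0) \<longlonglongrightarrow> (\<Sum>s\<in>S. \<mu> s * f s))"
proof -
  define \<delta> where "\<delta> s' s = (if s = s' then 1 else 0 :: real)" for s' s :: 's
  define \<mu> where "\<mu> s = lim (\<lambda>n. cesaro n (\<delta> s) s0)" for s
  have \<mu>: "(\<lambda>n. cesaro n (\<delta> s) s0) \<longlonglongrightarrow> \<mu> s" for s
    unfolding \<mu>_def using cesaro_convergent[OF s0] by (simp add: convergent_LIMSEQ_iff)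
  have lim: "(\<lambda>n. cesaro n f s0) \<longlonglongrightarrow> (\<Sum>s\<in>S. \<mu> s * f s)" for f
  proof -
    have "cesaro n f s0 = (\<Sum>s\<in>S. cesaro n (\<delta> s) s0 * f s)" for n
    proof -
      have "cesaro n f s0 = cesaro n (\<lambda>s. \<Sum>s'\<in>S. f s' * \<delta> s' s) s0"
        by (rule cesaro_cong) (use finite_S s0 in \<open>auto simp: \<delta>_def if_distrib[of "(*) _"] sum.delta cong: if_cong\<close>)
      then show ?thesis by (simp add: cesaro_sum mult.commute)
    qed
    then show ?thesis by (auto intro!: tendsto_intros \<mu>)
  qed
  have "0 \<le> \<mu> s" for s
  proof (rule LIMSEQ_le_const[OF \<mu>])
    show "\<exists>N. \<forall>n\<ge>N. 0 \<le> cesaro n (\<delta> s) s0"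
      using s0 by (auto simp: cesaro_def \<delta>_def intro!: divide_nonneg_nonneg sum_nonneg funpow_step_nonneg)
  qed
  moreover have "(\<Sum>s\<in>S. \<mu> s) = 1"
  proof -
    have "(step ^^ k) (\<lambda>_. 1) s0 = 1" for k
      by (rule funpow_step_fixed) (use s0 step_const in auto)
    then have "\<forall>\<^sub>F n in sequentially. cesaro n (\<lambda>_. 1) s0 = 1"
      by (intro eventually_mono[OF eventually_gt_at_top[of 0]]) (simp add: cesaro_def)
    then have "(\<lambda>n. cesaro n (\<lambda>_. 1) s0) \<longlonglongrightarrow> 1"
      by (rule tendsto_eventually)
    then show ?thesis using lim[of "\<lambda>_. 1"] LIMSEQ_unique by fastforce
  qed
  moreover have "(\<Sum>s\<in>S. \<mu> s * step f s) = (\<Sum>s\<in>S. \<mu> s * f s)" for f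
    using LIMSEQ_unique[OF tendsto_diff[OF lim[of "step f"] lim[of f]] cesaro_step_diff_tendsto[OF s0]]
    by simp
  ultimately show ?thesis using lim by blast
qed

end

subsection \<open>Sums and bounded functions\<close>

lemma finite_bounded_functions:
  "finite A \<Longrightarrow> finite {f. (\<forall>x. f x \<le> (n::nat)) \<and> (\<forall>x. x \<notin> A \<longrightarrow> f x = 0)}"
  by (rule finite_subset[OF _ finite_set_of_finite_funs[of A "{..n}" 0]]) auto

lemma finite_bounded_functions2:
  assumes "finite A" "finite B"
  shows "finite {f. (\<forall>x y. f x y \<le> (n::nat)) \<and> (\<forall>x y. f x y \<noteq> 0 \<longrightarrow> x \<in> A \<and> y \<in> B)}"
proof (rule finite_subset)
  show "{f. (\<forall>x y. f x y \<le> n) \<and> (\<forall>x y. f x y \<noteq> 0 \<longrightarrow> x \<in> A \<and> y \<in> B)}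
    \<subseteq> curry ` {f. (\<forall>x. f x \<le> n) \<and> (\<forall>x. x \<notin> A \<times> B \<longrightarrow> f x = 0)}"
    by (rule subsetI, rule_tac x = "case_prod x" in image_eqI) auto
qed (intro finite_imageI finite_bounded_functions finite_cartesian_product assms)

text \<open>Used to show that each entry of a decision vector reaches exactly one target status,
  \<open>i\<close> being its remaining time and \<open>j\<close> its battery. The conditions concern
  nonzero entries \<open>F\<close> only, since for a zero entry the target may fall outside the
  index sets.\<close>

lemma sum_sum_unique:
  assumes "finite A" "finite B" "F \<noteq> 0 \<Longrightarrow> i \<in> A \<and> j \<in> B"
    and "\<And>x y. F \<noteq> 0 \<Longrightarrow> P x y \<longleftrightarrow> x = i \<and> y = j"
  shows "(\<Sum>x\<in>A. \<Sum>y\<in>B. if P x y then F else 0) = (F :: 'a :: comm_monoid_add)"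
proof (cases "F = 0")
  case False
  then have "(\<Sum>x\<in>A. \<Sum>y\<in>B. if P x y then F else 0)
      = (\<Sum>x\<in>A. if x = i then \<Sum>y\<in>B. if y = j then F else 0 else 0)"
    using assms(4) by (intro sum.cong) auto
  then show ?thesis using assms False by simp
next
  case True
  then show ?thesis by (simp cong: if_cong)
qed

text \<open>This and the next three lemmas mainly serve to move the sums over the target status
  innermost, where \<open>sum_sum_unique\<close> evaluates them. The range \<open>I u\<close>
  depends on the region because \<open>max_task\<close> does.\<close>

lemma sum_push4:
  "(\<Sum>y\<in>Y. \<Sum>u\<in>U. \<Sum>i\<in>I u. \<Sum>j\<in>J. \<Sum>k\<in>K. g y u i j k)
    = (\<Sum>u\<in>U. \<Sum>i\<in>I u. \<Sum>j\<in>J. \<Sum>k\<in>K. \<Sum>y\<in>Y. g y u i j k)"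
  by (simp only: sum.swap[where B = Y])

lemma sum_push2:
  "(\<Sum>y\<in>Y. \<Sum>u\<in>U. \<Sum>i\<in>I. g y u i) = (\<Sum>u\<in>U. \<Sum>i\<in>I. \<Sum>y\<in>Y. g y u i)"
  by (simp only: sum.swap[where B = Y])

lemma sum_push22:
  "(\<Sum>x\<in>X. \<Sum>y\<in>Y. \<Sum>u\<in>U. \<Sum>i\<in>I. g x y u i) = (\<Sum>u\<in>U. \<Sum>i\<in>I. \<Sum>x\<in>X. \<Sum>y\<in>Y. g x y u i)"
  unfolding sum_push2[where Y = Y] by (rule sum_push2)

lemma sum_push24:
  "(\<Sum>x\<in>X. \<Sum>y\<in>Y. \<Sum>u\<in>U. \<Sum>i\<in>I u. \<Sum>j\<in>J. \<Sum>k\<in>K. g x y u i j k)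
    = (\<Sum>u\<in>U. \<Sum>i\<in>I u. \<Sum>j\<in>J. \<Sum>k\<in>K. \<Sum>x\<in>X. \<Sum>y\<in>Y. g x y u i j k)"
  unfolding sum_push4[where Y = Y] by (rule sum_push4)

lemma sum_idle:
  assumes "\<And>\<eta> b. h (u, \<eta>, b) \<noteq> 0 \<Longrightarrow> \<eta> = (0::nat)"
  shows "(\<Sum>\<eta>\<le>(n::nat). \<Sum>b\<in>B. h (u, \<eta>, b)) = (\<Sum>b\<in>B. h (u, 0, b) :: nat)"
proof -
  have "(\<Sum>\<eta>\<le>n. \<Sum>b\<in>B. h (u, \<eta>, b)) = (\<Sum>\<eta>\<in>{0}. \<Sum>b\<in>B. h (u, \<eta>, b))"
    using assms by (intro sum.mono_neutral_right) (fastforce intro!: sum.neutral)+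
  then show ?thesis by simp
qed

subsection \<open>The mean number of requests\<close>

lemma poisson_sums_mean:
  "(\<lambda>n. real n * (m ^ n / fact n * exp (- m))) sums (m :: real)"
proof -
  have "(\<lambda>n. m * exp (- m) * (m ^ n / fact n)) sums (m * exp (- m) * exp m)"
    using exp_converges[of m] by (intro sums_mult) (simp add: field_simps)
  moreover have "real (Suc n) * (m ^ Suc n / fact (Suc n) * exp (- m)) = m * exp (- m) * (m ^ n / fact n)"
    for n by (simp add: divide_simps)
  moreover have "m * exp (- m) * exp m = m"
    by (simp add: exp_minus)
  ultimately have "(\<lambda>n. real (Suc n) * (m ^ Suc n / fact (Suc n) * exp (- m))) sums m"
    by (simp only:)
  then show ?thesis by (subst (asm) sums_Suc_iff) simp
qed

text \<open>Capping can only lower the mean. The comparison is made with nonnegative integrals,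
  where the unbounded count has a mean without an integrability argument.\<close>

lemma expectation_min_requests_le:
  assumes "0 \<le> m"
  shows "measure_pmf.expectation (requests_pmf m) (\<lambda>n. real (min n k)) \<le> m"
proof (cases "0 < m")
  case True
  have nn: "0 \<le> real n * (m ^ n / fact n * exp (- m))" for n using assms by simp
  have "(\<integral>\<^sup>+n. ennreal (real (min n k)) \<partial>measure_pmf (poisson_pmf m))
      \<le> (\<integral>\<^sup>+n. ennreal (real n) \<partial>measure_pmf (poisson_pmf m))"
    by (intro nn_integral_mono) (simp add: ennreal_leI)
  also have "\<dots> = (\<Sum>n. ennreal (real n * (m ^ n / fact n * exp (- m))))"
    unfolding nn_integral_measure_pmf nn_integral_count_space_nat
  proof (intro arg_cong[where f = suminf] ext)
    fix n
    show "ennreal (pmf (poisson_pmf m) n) * ennreal (real n) = ennreal (real n * (m ^ n / fact n * exp (- m)))"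
      unfolding pmf_poisson[OF True] by (subst mult.commute, rule ennreal_mult'[symmetric]) simp
  qed
  also have "\<dots> = ennreal m"
    using poisson_sums_mean[of m] nn by (subst suminf_ennreal2) (auto simp: sums_iff)
  finally have "enn2real (\<integral>\<^sup>+n. ennreal (real (min n k)) \<partial>measure_pmf (poisson_pmf m)) \<le> m"
    using assms by (simp add: enn2real_leI)
  then show ?thesis
    using True by (simp add: requests_pmf_def integral_eq_nn_integral)
qed (use assms in \<open>simp add: requests_pmf_def\<close>)

subsection \<open>Finiteness and invariance of the state space\<close>

context robotaxi
begin

lemma day_time_range [simp]: "day_time M i \<in> {1..horizon M}"
  using horizon_ge_1 pos_mod_bound[of "int (horizon M)" "i - 1"]
  by (auto simp: day_time_def Suc_le_eq nat_less_iff)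

lemma day_time_id: "t \<in> {1..horizon M} \<Longrightarrow> day_time M (int t) = t"
  by (auto simp: day_time_def)

lemma int_day_time: "int (day_time M i) = (i - 1) mod int (horizon M) + 1"
  using horizon_ge_1 by (simp add: day_time_def)

text \<open>Lets times be computed as integers and reduced to a time of day only at the end, so that
  the change of day is no special case.\<close>

lemma day_time_add: "day_time M (int (day_time M i) + k) = day_time M (i + k)"
proof -
  have "(int (day_time M i) + k - 1) mod int (horizon M) = (i + k - 1) mod int (horizon M)"
    unfolding int_day_time by (simp add: mod_simps algebra_simps)
  then show ?thesis by (simp add: day_time_def)
qed

lemma day_time_Suc_eq_iff:
  assumes "t \<in> {1..horizon M}" "t' \<in> {1..horizon M}"
  shows "day_time M (int t + 1) = t' \<longleftrightarrow> t = day_time M (int t' - 1)"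
  using day_time_add[of "int t + 1" "- 1"] day_time_add[of "int t' - 1" 1] assms day_time_id by fastforce

lemma finite_vehicle_statuses [simp]: "finite (vehicle_statuses M)"
proof (rule finite_subset)
  show "vehicle_statuses M \<subseteq> (SIGMA v:regions M. {..max_task M v} \<times> {..range_max M})"
    by (auto simp: vehicle_statuses_def)
qed (use finite_regions in auto)

lemma finite_trip_statuses [simp]: "finite (trip_statuses M)"
proof (rule finite_subset)
  show "trip_statuses M \<subseteq> regions M \<times> regions M \<times> {..conn_patience M}"
    by (auto simp: trip_statuses_def)
qed (use finite_regions in auto)

lemma finite_charger_statuses [simp]: "finite (charger_statuses M)"
proof (rule finite_subset)
  show "charger_statuses M \<subseteq> regions M \<times> rates M \<times> {..<charge_period M}"
    by (auto simp: charger_statuses_def)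
qed (use finite_regions finite_rates in auto)

lemma sum_vehicle_statuses:
  "(\<Sum>c\<in>vehicle_statuses M. f c) = (\<Sum>v\<in>regions M. \<Sum>\<eta>\<le>max_task M v. \<Sum>b\<le>range_max M. f (v, \<eta>, b))"
proof -
  have "vehicle_statuses M = (SIGMA v:regions M. {..max_task M v} \<times> {..range_max M})"
    by (auto simp: vehicle_statuses_def)
  then show ?thesis
    using finite_regions by (simp add: sum.cartesian_product sum.Sigma case_prod_unfold)
qed

lemma sum_trip_statuses:
  "(\<Sum>k\<in>trip_statuses M. f k) = (\<Sum>u\<in>regions M. \<Sum>v\<in>regions M. \<Sum>\<xi>\<le>conn_patience M. f (u, v, \<xi>))"
proof -
  have "trip_statuses M = regions M \<times> regions M \<times> {..conn_patience M}"
    by (auto simp: trip_statuses_def)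
  then show ?thesis using finite_regions by (simp add: sum.cartesian_product)
qed

lemma stateD:
  assumes "s \<in> states M"
  shows "time s \<in> {1..horizon M}"
    and "(\<Sum>c\<in>vehicle_statuses M. vehicles s c) = fleet M"
    and "v \<in> regions M \<Longrightarrow> \<delta> \<in> rates M \<Longrightarrow>
      (\<Sum>j<charge_period M. avail s (v, \<delta>, j)) = chargers M v \<delta>"
    and "k \<in> trip_statuses M \<Longrightarrow> trips s k \<le> fleet M * (conn_patience M + 1)"
    and "c \<notin> vehicle_statuses M \<Longrightarrow> vehicles s c = 0"
    and "k \<notin> trip_statuses M \<Longrightarrow> trips s k = 0"
    and "w \<notin> charger_statuses M \<Longrightarrow> avail s w = 0"
  using assms unfolding states_def by blast+

lemma finite_states: "finite (states M)"
proof -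
  \<comment> \<open>One bound for all counts: the first summand covers vehicles and trips, the
    second the chargers of every region and rate.\<close>
  define n where "n = fleet M * (conn_patience M + 1) + (\<Sum>v\<in>regions M. \<Sum>\<delta>\<in>rates M. chargers M v \<delta>)"
  let ?V = "{f. (\<forall>c. f c \<le> n) \<and> (\<forall>c. c \<notin> vehicle_statuses M \<longrightarrow> f c = 0)}"
  let ?T = "{f. (\<forall>c. f c \<le> n) \<and> (\<forall>c. c \<notin> trip_statuses M \<longrightarrow> f c = 0)}"
  let ?C = "{f. (\<forall>c. f c \<le> n) \<and> (\<forall>c. c \<notin> charger_statuses M \<longrightarrow> f c = 0)}"
  let ?g = "\<lambda>(t, v, k, w). \<lparr>time = t, vehicles = v, trips = k, avail = w\<rparr>"
  have "states M \<subseteq> ?g ` ({1..horizon M} \<times> ?V \<times> ?T \<times> ?C)"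
  proof
    fix s assume s: "s \<in> states M"
    have "vehicles s c \<le> n" for c
    proof (cases "c \<in> vehicle_statuses M")
      case True
      then have "vehicles s c \<le> (\<Sum>c\<in>vehicle_statuses M. vehicles s c)"
        by (intro member_le_sum) auto
      also have "\<dots> \<le> n" using s by (auto simp: states_def n_def)
      finally show ?thesis .
    qed (simp add: stateD[OF s])
    moreover have "trips s k \<le> n" for k
      using stateD(4,6)[OF s, of k]
      by (cases "k \<in> trip_statuses M") (auto simp: n_def intro: trans_le_add1)
    moreover have "avail s w \<le> n" for w
    proof (cases "w \<in> charger_statuses M")
      case True
      obtain v \<delta> j where w: "w = (v, \<delta>, j)" by (cases w)
      have "avail s w \<le> (\<Sum>j<charge_period M. avail s (v, \<delta>, j))"
        using True by (auto simp: w charger_statuses_def intro!: member_le_sum[where f = "\<lambda>j. avail s (v, \<delta>, j)"])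
      also have "\<dots> = chargers M v \<delta>"
        using s True by (auto simp: states_def w charger_statuses_def)
      also have "\<dots> \<le> (\<Sum>\<delta>\<in>rates M. chargers M v \<delta>)"
        using True finite_rates by (intro member_le_sum) (auto simp: w charger_statuses_def)
      also have "\<dots> \<le> (\<Sum>v\<in>regions M. \<Sum>\<delta>\<in>rates M. chargers M v \<delta>)"
        using True finite_regions
        by (intro member_le_sum[where f = "\<lambda>v. \<Sum>\<delta>\<in>rates M. chargers M v \<delta>"])
          (auto simp: w charger_statuses_def)
      finally show ?thesis by (simp add: n_def)
    qed (simp add: stateD[OF s])
    ultimately show "s \<in> ?g ` ({1..horizon M} \<times> ?V \<times> ?T \<times> ?C)"
      using stateD(1,5-7)[OF s]
      by (intro image_eqI[of _ _ "(time s, vehicles s, trips s, avail s)"]) (simp_all del: split_paired_All)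
  qed
  then show ?thesis
    by (rule finite_subset) (intro finite_imageI finite_cartesian_product finite_bounded_functions; simp)
qed

lemma actionD:
  assumes "a \<in> actions M s"
  shows "fulfil a (u, \<eta>, b) (u', v, \<xi>) \<noteq> 0 \<Longrightarrow> (u, \<eta>, b) \<in> vehicle_statuses M \<and>
      (u', v, \<xi>) \<in> trip_statuses M \<and> u = u' \<and> \<eta> \<le> pickup_patience M \<and> b \<ge> consumption M u v"
    and "reposition a (u, \<eta>, b) v \<noteq> 0 \<Longrightarrow> (u, \<eta>, b) \<in> vehicle_statuses M \<and> v \<in> regions M \<and>
      \<eta> = 0 \<and> u \<noteq> v \<and> b \<ge> consumption M u v"
    and "charge a (u, \<eta>, b) \<delta> \<noteq> 0 \<Longrightarrow> (u, \<eta>, b) \<in> vehicle_statuses M \<and> \<delta> \<in> rates M \<and> \<eta> = 0"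
    and "pass a c \<noteq> 0 \<Longrightarrow> c \<in> vehicle_statuses M"
    and "c \<in> vehicle_statuses M \<Longrightarrow> decision_total M a c = vehicles s c"
    and "k \<in> trip_statuses M \<Longrightarrow> (\<Sum>c\<in>vehicle_statuses M. fulfil a c k) \<le> trips s k"
    and "v \<in> regions M \<Longrightarrow> \<delta> \<in> rates M \<Longrightarrow>
      (\<Sum>\<eta>\<le>max_task M v. \<Sum>b\<le>range_max M. charge a (v, \<eta>, b) \<delta>) \<le> avail s (v, \<delta>, 0)"
proof -
  note A = assms[unfolded actions_def mem_Collect_eq]
  note A2 = A[THEN conjunct2, THEN conjunct2]
  note A4 = A2[THEN conjunct2, THEN conjunct2]
  show "fulfil a (u, \<eta>, b) (u', v, \<xi>) \<noteq> 0 \<Longrightarrow> (u, \<eta>, b) \<in> vehicle_statuses M \<and>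
      (u', v, \<xi>) \<in> trip_statuses M \<and> u = u' \<and> \<eta> \<le> pickup_patience M \<and> b \<ge> consumption M u v"
    by (rule A[THEN conjunct1, rule_format])
  show "k \<in> trip_statuses M \<Longrightarrow> (\<Sum>c\<in>vehicle_statuses M. fulfil a c k) \<le> trips s k"
    by (rule A[THEN conjunct2, THEN conjunct1, rule_format])
  show "reposition a (u, \<eta>, b) v \<noteq> 0 \<Longrightarrow> (u, \<eta>, b) \<in> vehicle_statuses M \<and> v \<in> regions M \<and>
      \<eta> = 0 \<and> u \<noteq> v \<and> b \<ge> consumption M u v"
    by (rule A2[THEN conjunct1, rule_format])
  show "charge a (u, \<eta>, b) \<delta> \<noteq> 0 \<Longrightarrow> (u, \<eta>, b) \<in> vehicle_statuses M \<and> \<delta> \<in> rates M \<and> \<eta> = 0"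
    by (rule A2[THEN conjunct2, THEN conjunct1, rule_format])
  show "v \<in> regions M \<Longrightarrow> \<delta> \<in> rates M \<Longrightarrow>
      (\<Sum>\<eta>\<le>max_task M v. \<Sum>b\<le>range_max M. charge a (v, \<eta>, b) \<delta>) \<le> avail s (v, \<delta>, 0)"
    by (rule A4[THEN conjunct1, rule_format])
  show "pass a c \<noteq> 0 \<Longrightarrow> c \<in> vehicle_statuses M"
    by (rule A4[THEN conjunct2, THEN conjunct1, rule_format])
  show "c \<in> vehicle_statuses M \<Longrightarrow> decision_total M a c = vehicles s c"
    by (rule A4[THEN conjunct2, THEN conjunct2, rule_format])
qed

lemma sum_charge_eq:
  assumes "a \<in> actions M s"
  shows "(\<Sum>\<eta>\<le>max_task M v. \<Sum>b\<le>range_max M. charge a (v, \<eta>, b) \<delta>)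
       = (\<Sum>b\<le>range_max M. charge a (v, 0, b) \<delta>)"
proof -
  have "(\<Sum>\<eta>\<le>max_task M v. \<Sum>b\<le>range_max M. charge a (v, \<eta>, b) \<delta>)
      = (\<Sum>\<eta>\<in>{0}. \<Sum>b\<le>range_max M. charge a (v, \<eta>, b) \<delta>)"
    using actionD(3)[OF assms] by (intro sum.mono_neutral_right) (force intro!: sum.neutral)+
  then show ?thesis by simp
qed

lemma sum_charge_le_avail:
  assumes "a \<in> actions M s" "v \<in> regions M" "\<delta> \<in> rates M"
  shows "(\<Sum>b\<le>range_max M. charge a (v, 0, b) \<delta>) \<le> avail s (v, \<delta>, 0)"
  using actionD(7)[OF assms] sum_charge_eq[OF assms(1)] by simp

text \<open>A nonzero entry is a summand of \<open>decision_total M a c\<close> for some status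
  \<open>c\<close>, which is a vehicle count and so at most the fleet size. Vanishing outside the
  index sets then leaves finitely many functions.\<close>

lemma finite_actions:
  assumes "s \<in> states M"
  shows "finite (actions M s)"
proof -
  let ?F = "{f. (\<forall>c k. f c k \<le> fleet M) \<and> (\<forall>c k. f c k \<noteq> 0 \<longrightarrow> c \<in> vehicle_statuses M \<and> k \<in> trip_statuses M)}"
  let ?E = "{f. (\<forall>c v. f c v \<le> fleet M) \<and> (\<forall>c v. f c v \<noteq> 0 \<longrightarrow> c \<in> vehicle_statuses M \<and> v \<in> regions M)}"
  let ?Q = "{f. (\<forall>c \<delta>. f c \<delta> \<le> fleet M) \<and> (\<forall>c \<delta>. f c \<delta> \<noteq> 0 \<longrightarrow> c \<in> vehicle_statuses M \<and> \<delta> \<in> rates M)}"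
  let ?P = "{f. (\<forall>c. f c \<le> fleet M) \<and> (\<forall>c. c \<notin> vehicle_statuses M \<longrightarrow> f c = 0)}"
  let ?g = "\<lambda>(f, e, q, p). \<lparr>fulfil = f, reposition = e, charge = q, pass = p\<rparr>"
  have "actions M s \<subseteq> ?g ` (?F \<times> ?E \<times> ?Q \<times> ?P)"
  proof
    fix a assume a: "a \<in> actions M s"
    have total: "decision_total M a c \<le> fleet M" if "c \<in> vehicle_statuses M" for c
    proof -
      have "vehicles s c \<le> (\<Sum>c\<in>vehicle_statuses M. vehicles s c)"
        using that by (intro member_le_sum) auto
      then show ?thesis using assms actionD(5)[OF a that] by (auto simp: states_def)
    qed
    have f: "c \<in> vehicle_statuses M \<and> k \<in> trip_statuses M" if "fulfil a c k \<noteq> 0" for c k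
      using actionD(1)[OF a] that by (cases c; cases k) blast
    have e: "c \<in> vehicle_statuses M \<and> v \<in> regions M" if "reposition a c v \<noteq> 0" for c v
      using actionD(2)[OF a] that by (cases c) blast
    have q: "c \<in> vehicle_statuses M \<and> \<delta> \<in> rates M" if "charge a c \<delta> \<noteq> 0" for c \<delta>
      using actionD(3)[OF a] that by (cases c) blast
    have "fulfil a c k \<le> fleet M" for c k
    proof (cases "fulfil a c k = 0")
      case False
      then have "fulfil a c k \<le> (\<Sum>k\<in>trip_statuses M. fulfil a c k)"
        using f by (intro member_le_sum) auto
      then show ?thesis using total[of c] f[OF False] by (simp add: decision_total_def)
    qed simp
    moreover have "reposition a c v \<le> fleet M" for c v
    proof (cases "reposition a c v = 0")
      case False
      then have "reposition a c v \<le> (\<Sum>v\<in>regions M. reposition a c v)"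
        using e finite_regions by (intro member_le_sum) auto
      then show ?thesis using total[of c] e[OF False] by (simp add: decision_total_def)
    qed simp
    moreover have "charge a c \<delta> \<le> fleet M" for c \<delta>
    proof (cases "charge a c \<delta> = 0")
      case False
      then have "charge a c \<delta> \<le> (\<Sum>\<delta>\<in>rates M. charge a c \<delta>)"
        using q finite_rates by (intro member_le_sum) auto
      then show ?thesis using total[of c] q[OF False] by (simp add: decision_total_def)
    qed simp
    moreover have "pass a c \<le> fleet M" for c
      using total[of c] actionD(4)[OF a, of c] by (cases "pass a c = 0") (auto simp: decision_total_def)
    moreover have "pass a c = 0" if "c \<notin> vehicle_statuses M" for c
      using actionD(4)[OF a] that by blast
    ultimately show "a \<in> ?g ` (?F \<times> ?E \<times> ?Q \<times> ?P)"
      using f e q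
      by (intro image_eqI[of _ _ "(fulfil a, reposition a, charge a, pass a)"]) (simp_all del: split_paired_All)
  qed
  then show ?thesis
    by (rule finite_subset)
      (intro finite_imageI finite_cartesian_product finite_bounded_functions finite_bounded_functions2;
        simp add: finite_regions finite_rates)
qed

lemma pass_all_action:
  assumes "s \<in> states M"
  shows "\<lparr>fulfil = \<lambda>_ _. 0, reposition = \<lambda>_ _. 0, charge = \<lambda>_ _. 0, pass = vehicles s\<rparr> \<in> actions M s"
proof -
  have "\<forall>c. vehicles s c \<noteq> 0 \<longrightarrow> c \<in> vehicle_statuses M" 
    by (intro allI impI) (rule ccontr, simp add: stateD(5)[OF assms])
  then show ?thesis unfolding actions_def decision_total_def by simp
qed

section \<open>Conservation of vehicles and chargers under a transition\<close>

lemma charge_period_pos: "0 < charge_period M"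
  using charge_period_gt_patience by simp

lemma travel_time_le_max_task:
  assumes "u \<in> regions M" "v \<in> regions M" "t \<in> {1..horizon M}"
  shows "travel_time M u v t + pickup_patience M \<le> max_task M v"
proof -
  have "finite {travel_time M u v t |u t. u \<in> regions M \<and> t \<in> {1..horizon M}}"
    by (rule finite_image_set2) (simp_all add: finite_regions)
  then have "travel_time M u v t \<le> max_travel_time M v"
    unfolding max_travel_time_def using assms by (intro Max_ge) blast+
  then show ?thesis by (simp add: max_task_def)
qed

text \<open>A vehicle assigned to a trip arrives in exactly one status. Its remaining time stays in
  range because at most \<open>pickup_patience M\<close> was left before the trip, the allowance
  built into \<open>max_task\<close>. Summing over targets first therefore returns every entry
  once.\<close>

lemma sum_flow_fulfil:
  assumes a: "a \<in> actions M s" and t: "t \<in> {1..horizon M}"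
  shows "(\<Sum>v\<in>regions M. \<Sum>\<eta>\<le>max_task M v. \<Sum>b\<le>range_max M.
      \<Sum>u\<in>regions M. \<Sum>\<eta>'\<le>max_task M u. \<Sum>b'\<le>range_max M. \<Sum>\<xi>\<le>conn_patience M.
        if \<eta>' + travel_time M u v t = \<eta> + 1 \<and> b' = b + consumption M u v
        then fulfil a (u, \<eta>', b') (u, v, \<xi>) else 0)
    = (\<Sum>c\<in>vehicle_statuses M. \<Sum>k\<in>trip_statuses M. fulfil a c k)" (is "?l = ?r")
proof -
  have "?l = (\<Sum>v\<in>regions M. \<Sum>u\<in>regions M. \<Sum>\<eta>'\<le>max_task M u. \<Sum>b'\<le>range_max M. \<Sum>\<xi>\<le>conn_patience M.
      fulfil a (u, \<eta>', b') (u, v, \<xi>))"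
    unfolding sum_push24
  proof (intro sum.cong refl)
    fix v u \<eta>' b' \<xi> assume *: "v \<in> regions M" "u \<in> regions M" "b' \<in> {..range_max M}"
    let ?F = "fulfil a (u, \<eta>', b') (u, v, \<xi>)"
    have F: "\<eta>' \<le> pickup_patience M" "consumption M u v \<le> b'" if "?F \<noteq> 0"
      using actionD(1)[OF a that] by auto
    \<comment> \<open>The subtractions in the witnesses \<open>i\<close> and \<open>j\<close> are
      exact when the entry is nonzero: travel times exceed the patience and so are positive, and the
      battery covers the consumption.\<close>
    show "(\<Sum>\<eta>\<le>max_task M v. \<Sum>b\<le>range_max M.
        if \<eta>' + travel_time M u v t = \<eta> + 1 \<and> b' = b + consumption M u v then ?F else 0) = ?F"
      using F * travel_time_gt_patience[OF *(2,1) t] travel_time_le_max_task[OF *(2,1) t]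
      by (intro sum_sum_unique[where i = "\<eta>' + travel_time M u v t - 1" and j = "b' - consumption M u v"])
        force+
  qed
  also have "\<dots> = (\<Sum>u\<in>regions M. \<Sum>\<eta>'\<le>max_task M u. \<Sum>b'\<le>range_max M.
      \<Sum>v\<in>regions M. \<Sum>\<xi>\<le>conn_patience M. fulfil a (u, \<eta>', b') (u, v, \<xi>))"
    by (subst sum.swap) (rule sum.cong[OF refl], rule sum_push2)
  also have "\<dots> = ?r"
    unfolding sum_vehicle_statuses sum_trip_statuses
  proof (rule sum.cong[OF refl], rule sum.cong[OF refl], rule sum.cong[OF refl])
    fix u \<eta>' b' assume u: "u \<in> regions M"
    have "(\<Sum>u'\<in>regions M. \<Sum>v\<in>regions M. \<Sum>\<xi>\<le>conn_patience M. fulfil a (u, \<eta>', b') (u', v, \<xi>))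
        = (\<Sum>u'\<in>{u}. \<Sum>v\<in>regions M. \<Sum>\<xi>\<le>conn_patience M. fulfil a (u, \<eta>', b') (u', v, \<xi>))"
      using actionD(1)[OF a] u finite_regions
      by (intro sum.mono_neutral_right) (fastforce intro!: sum.neutral)+
    then show "(\<Sum>v\<in>regions M. \<Sum>\<xi>\<le>conn_patience M. fulfil a (u, \<eta>', b') (u, v, \<xi>))
      = (\<Sum>u'\<in>regions M. \<Sum>v\<in>regions M. \<Sum>\<xi>\<le>conn_patience M. fulfil a (u, \<eta>', b') (u', v, \<xi>))"
      by simp
  qed
  finally show ?thesis .
qed

lemma sum_flow_reposition:
  assumes a: "a \<in> actions M s" and t: "t \<in> {1..horizon M}"
  shows "(\<Sum>v\<in>regions M. \<Sum>\<eta>\<le>max_task M v. \<Sum>b\<le>range_max M. \<Sum>u\<in>regions M. \<Sum>b'\<le>range_max M.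
        if travel_time M u v t = \<eta> + 1 \<and> b' = b + consumption M u v
        then reposition a (u, 0, b') v else 0)
    = (\<Sum>c\<in>vehicle_statuses M. \<Sum>v\<in>regions M. reposition a c v)" (is "?l = ?r")
proof -
  have "?l = (\<Sum>v\<in>regions M. \<Sum>u\<in>regions M. \<Sum>b'\<le>range_max M. reposition a (u, 0, b') v)"
    unfolding sum_push22[where X = "{..max_task M _}"]
  proof (intro sum.cong refl)
    fix v u b' assume *: "v \<in> regions M" "u \<in> regions M" "b' \<in> {..range_max M}"
    let ?F = "reposition a (u, 0, b') v"
    have F: "consumption M u v \<le> b'" if "?F \<noteq> 0"
      using actionD(2)[OF a that] by auto
    show "(\<Sum>\<eta>\<le>max_task M v. \<Sum>b\<le>range_max M.
        if travel_time M u v t = \<eta> + 1 \<and> b' = b + consumption M u v then ?F else 0) = ?F"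
      using F * travel_time_gt_patience[OF *(2,1) t] travel_time_le_max_task[OF *(2,1) t]
      by (intro sum_sum_unique[where i = "travel_time M u v t - 1" and j = "b' - consumption M u v"]) force+
  qed
  also have "\<dots> = (\<Sum>v\<in>regions M. \<Sum>u\<in>regions M. \<Sum>\<eta>\<le>max_task M u. \<Sum>b'\<le>range_max M. reposition a (u, \<eta>, b') v)"
    using actionD(2)[OF a] by (intro sum.cong refl sum_idle[symmetric]) blast
  also have "\<dots> = ?r"
    unfolding sum_vehicle_statuses
    by (subst sum.swap) (rule sum.cong[OF refl], rule sum_push2)
  finally show ?thesis .
qed

lemma sum_flow_charge:
  assumes a: "a \<in> actions M s"
  shows "(\<Sum>v\<in>regions M. \<Sum>\<eta>\<le>max_task M v. \<Sum>b\<le>range_max M.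
      (\<Sum>\<delta>\<in>rates M. if \<eta> + 1 = charge_period M \<and> charge_gain M \<delta> \<le> b
        then charge a (v, 0, b - charge_gain M \<delta>) \<delta> else 0)
    + (\<Sum>\<delta>\<in>rates M. \<Sum>b' | b' \<le> range_max M \<and> range_max M < b' + charge_gain M \<delta>.
        if \<eta> + 1 = charge_period M \<and> b = range_max M then charge a (v, 0, b') \<delta> else 0))
    = (\<Sum>c\<in>vehicle_statuses M. \<Sum>\<delta>\<in>rates M. charge a c \<delta>)" (is "?l = ?r")
proof -
  let ?q = "\<lambda>v b' \<delta>. charge a (v, 0, b') \<delta>"
  \<comment> \<open>Uncapped and capped charging merge into one sum over the initial battery
    \<open>b'\<close>, with target \<open>min (range_max M) (b' + charge_gain M \<delta>)\<close>. A
    vehicle that reaches the range exactly belongs to the uncapped part \<open>?U\<close>.\<close>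
  have 1: "(if \<eta> + 1 = charge_period M \<and> charge_gain M \<delta> \<le> b then ?q v (b - charge_gain M \<delta>) \<delta> else 0)
     + (\<Sum>b' | b' \<le> range_max M \<and> range_max M < b' + charge_gain M \<delta>.
          if \<eta> + 1 = charge_period M \<and> b = range_max M then ?q v b' \<delta> else 0)
     = (\<Sum>b'\<le>range_max M. if \<eta> + 1 = charge_period M \<and> b = min (range_max M) (b' + charge_gain M \<delta>)
          then ?q v b' \<delta> else 0)" (is "?A + ?B = ?C") if b: "b \<le> range_max M" for v \<eta> b \<delta>
  proof -
    let ?U = "{b'. b' \<le> range_max M \<and> b' + charge_gain M \<delta> \<le> range_max M}"
    let ?W = "{b'. b' \<le> range_max M \<and> range_max M < b' + charge_gain M \<delta>}"
    let ?h = "\<lambda>b'. if \<eta> + 1 = charge_period M \<and> b = min (range_max M) (b' + charge_gain M \<delta>)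
          then ?q v b' \<delta> else 0"
    have fin: "finite ?U" "finite ?W" by auto
    have "{..range_max M} = ?U \<union> ?W" by auto
    then have "?C = sum ?h (?U \<union> ?W)" by simp
    also have "\<dots> = sum ?h ?U + sum ?h ?W"
      by (rule sum.union_disjoint) auto
    also have "sum ?h ?W = ?B"
      by (intro sum.cong) auto
    also have "sum ?h ?U = ?A"
    proof (cases "charge_gain M \<delta> \<le> b")
      case True
      have "sum ?h ?U = (\<Sum>b'\<in>?U. if b' = b - charge_gain M \<delta> then
          (if \<eta> + 1 = charge_period M then ?q v b' \<delta> else 0) else 0)"
        using True by (intro sum.cong) auto
      also have "\<dots> = ?A"
        using True b fin less_imp_diff_less[of b "range_max M + 1" "charge_gain M \<delta>"] by auto
      finally show ?thesis .
    next
      case False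
      then show ?thesis by (auto intro!: sum.neutral)
    qed
    finally show ?thesis by simp
  qed
  have "?l = (\<Sum>v\<in>regions M. \<Sum>\<eta>\<le>max_task M v. \<Sum>b\<le>range_max M. \<Sum>\<delta>\<in>rates M. \<Sum>b'\<le>range_max M.
      if \<eta> + 1 = charge_period M \<and> b = min (range_max M) (b' + charge_gain M \<delta>) then ?q v b' \<delta> else 0)"
    by (intro sum.cong refl) (simp only: sum.distrib[symmetric] 1 atMost_iff)
  also have "\<dots> = (\<Sum>v\<in>regions M. \<Sum>\<delta>\<in>rates M. \<Sum>b'\<le>range_max M. ?q v b' \<delta>)"
    unfolding sum_push22[where X = "{..max_task M _}"]
  proof (intro sum.cong refl)
    fix v \<delta> b'
    show "(\<Sum>\<eta>\<le>max_task M v. \<Sum>b\<le>range_max M.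
        if \<eta> + 1 = charge_period M \<and> b = min (range_max M) (b' + charge_gain M \<delta>) then ?q v b' \<delta> else 0)
      = ?q v b' \<delta>"
      using charge_period_pos
      by (intro sum_sum_unique[where i = "charge_period M - 1" and j = "min (range_max M) (b' + charge_gain M \<delta>)"])
        (auto simp: max_task_def)
  qed
  also have "\<dots> = (\<Sum>v\<in>regions M. \<Sum>\<delta>\<in>rates M. \<Sum>\<eta>\<le>max_task M v. \<Sum>b'\<le>range_max M. charge a (v, \<eta>, b') \<delta>)"
    using actionD(3)[OF a] by (intro sum.cong refl sum_idle[symmetric]) blast
  also have "\<dots> = ?r"
    unfolding sum_vehicle_statuses
    by (rule sum.cong[OF refl], rule sum_push2)
  finally show ?thesis .
qed

text \<open>Idle vehicles stay at remaining time \<open>0\<close> and all others count down by one,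
  so the two summands cover the entries at \<open>0\<close> and at
  \<open>1, ..., max_task M v\<close> once each.\<close>

lemma sum_flow_pass:
  "(\<Sum>v\<in>regions M. \<Sum>\<eta>\<le>max_task M v. \<Sum>b\<le>range_max M.
      (if \<eta> = 0 then pass a (v, \<eta>, b) else 0) + (if \<eta> < max_task M v then pass a (v, \<eta> + 1, b) else 0))
    = (\<Sum>c\<in>vehicle_statuses M. pass a c :: nat)"
  unfolding sum_vehicle_statuses
proof (rule sum.cong[OF refl])
  fix v
  have shift: "(\<Sum>\<eta>\<le>n. (if \<eta> = 0 then p \<eta> else 0) + (if \<eta> < n then p (\<eta> + 1) else 0)) = (\<Sum>\<eta>\<le>n. p \<eta>)"
    for n and p :: "nat \<Rightarrow> nat"
  proof -
    have "(\<Sum>\<eta>\<le>n. if \<eta> < n then p (\<eta> + 1) else 0) = (\<Sum>\<eta><n. p (Suc \<eta>))"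
      by (intro sum.mono_neutral_cong_right) auto
    then show ?thesis by (simp add: sum.distrib sum.atMost_shift)
  qed
  show "(\<Sum>\<eta>\<le>max_task M v. \<Sum>b\<le>range_max M.
      (if \<eta> = 0 then pass a (v, \<eta>, b) else 0) + (if \<eta> < max_task M v then pass a (v, \<eta> + 1, b) else 0))
    = (\<Sum>\<eta>\<le>max_task M v. \<Sum>b\<le>range_max M. pass a (v, \<eta>, b))"
    by (subst (1 2) sum.swap, rule sum.cong[OF refl]) (rule shift)
qed

lemma sum_flow:
  assumes a: "a \<in> actions M s" and t: "t \<in> {1..horizon M}"
  shows "(\<Sum>c\<in>vehicle_statuses M. flow M t a c) = (\<Sum>c\<in>vehicle_statuses M. decision_total M a c)"
proof -
  have "(\<Sum>c\<in>vehicle_statuses M. flow M t a c)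
      = (\<Sum>c\<in>vehicle_statuses M. \<Sum>k\<in>trip_statuses M. fulfil a c k)
      + (\<Sum>c\<in>vehicle_statuses M. \<Sum>v\<in>regions M. reposition a c v)
      + (\<Sum>c\<in>vehicle_statuses M. \<Sum>\<delta>\<in>rates M. charge a c \<delta>) + (\<Sum>c\<in>vehicle_statuses M. pass a c)"
    unfolding sum_vehicle_statuses[of "flow M t a"] flow.simps sum_flow_fulfil[OF a t, symmetric]
      sum_flow_reposition[OF a t, symmetric] sum_flow_charge[OF a, symmetric] sum_flow_pass[symmetric]
      sum.distrib
    by (simp only: add_ac)
  then show ?thesis by (simp add: decision_total_def sum.distrib)
qed

lemma sum_next_avail:
  assumes s: "s \<in> states M" and a: "a \<in> actions M s" and v: "v \<in> regions M" "\<delta> \<in> rates M"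
  shows "(\<Sum>j<charge_period M. avail (next_state M s a X) (v, \<delta>, j)) = chargers M v \<delta>"
proof (cases "charge_period M = 1")
  case True
  then show ?thesis using v by (simp add: next_state_def charger_statuses_def)
next
  case False
  \<comment> \<open>The first, the last and the \<open>n\<close> middle positions follow different
    rules; the middle ones merely shift.\<close>
  define n where "n = charge_period M - 2"
  have J: "charge_period M = Suc (Suc n)" using False charge_period_pos by (simp add: n_def)
  have mem: "(v, \<delta>, j) \<in> charger_statuses M" if "j < Suc (Suc n)" for j
    using that v by (simp add: charger_statuses_def J)
  let ?q = "\<Sum>b\<le>range_max M. charge a (v, 0, b) \<delta>"
  let ?s = "\<lambda>j. avail s (v, \<delta>, j)"
  have "(\<Sum>j<charge_period M. avail (next_state M s a X) (v, \<delta>, j))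
      = avail (next_state M s a X) (v, \<delta>, 0) + (\<Sum>j<n. avail (next_state M s a X) (v, \<delta>, Suc j))
        + avail (next_state M s a X) (v, \<delta>, Suc n)"
    unfolding J by (subst sum.lessThan_Suc, subst sum.lessThan_Suc_shift) simp
  also have "\<dots> = (?s 1 + ?s 0 - ?q) + (\<Sum>j<n. ?s (Suc (Suc j))) + ?q"
    by (simp add: next_state_def mem J)
  \<comment> \<open>The natural subtraction of \<open>?q\<close> has to be exact here, which is what
    \<open>sum_charge_le_avail\<close> ensures.\<close>
  also have "\<dots> = (\<Sum>j<charge_period M. ?s j)"
    using sum_charge_le_avail[OF a v] unfolding J
    by (simp add: sum.lessThan_Suc_shift del: sum.lessThan_Suc)
  also have "\<dots> = chargers M v \<delta>"
    by (rule stateD(3)[OF s v])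
  finally show ?thesis .
qed

lemma next_state_in_states:
  assumes s: "s \<in> states M" and a: "a \<in> actions M s"
  shows "next_state M s a X \<in> states M"
proof -
  have "(\<Sum>c\<in>vehicle_statuses M. vehicles (next_state M s a X) c) = fleet M"
    using sum_flow[OF a stateD(1)[OF s]] actionD(5)[OF a] stateD(2)[OF s] by (simp add: next_state_def)
  moreover have "trips (next_state M s a X) k \<le> fleet M * (conn_patience M + 1)"
    if k: "k \<in> trip_statuses M" for k
  proof -
    obtain u v \<xi> where k_eq: "k = (u, v, \<xi>)" by (cases k)
    have "trips s (u, v, \<xi> - 1) \<le> fleet M * (conn_patience M + 1)"
      using k by (intro stateD(4)[OF s]) (auto simp: k_eq trip_statuses_def)
    then show ?thesis using k unfolding next_state_def by (auto simp: k_eq)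
  qed
  ultimately show ?thesis
    using sum_next_avail[OF s a] day_time_range[of "int (time s) + 1"] unfolding states_def
    by (auto simp: next_state_def)
qed

end

subsection \<open>Average reward of a policy\<close>

locale robotaxi_policy = robotaxi +
  fixes \<pi> :: "'a policy"
  assumes policy: "\<pi> \<in> policies M"
begin

abbreviation kernel :: "'a state \<Rightarrow> 'a state pmf" where
  "kernel s \<equiv> bind_pmf (\<pi> s) (transition M s)"

text \<open>Averaging out the action turns the reward into a function of the state alone, to which
  the operators of the state chain apply.\<close>

definition expected_reward :: "'a state \<Rightarrow> real" where
  "expected_reward s = (\<Sum>a\<in>actions M s. pmf (\<pi> s) a * reward M (time s) (real_decision a))"

lemma set_policy: "s \<in> states M \<Longrightarrow> set_pmf (\<pi> s) \<subseteq> actions M s"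
  using policy by (simp add: policies_def)

lemma sum_policy: "s \<in> states M \<Longrightarrow> (\<Sum>a\<in>actions M s. pmf (\<pi> s) a) = 1"
  by (intro sum_pmf_eq_1 finite_actions set_policy)

lemma set_transition: "s \<in> states M \<Longrightarrow> a \<in> actions M s \<Longrightarrow> set_pmf (transition M s a) \<subseteq> states M"
  by (auto simp: transition_def next_state_in_states)

lemma finite_set_transition: "s \<in> states M \<Longrightarrow> a \<in> actions M s \<Longrightarrow> finite (set_pmf (transition M s a))"
  using set_transition finite_states finite_subset by blast

sublocale finite_markov "states M" kernel
proof
  show "set_pmf (kernel s) \<subseteq> states M" if "s \<in> states M" for s
    using set_transition[OF that] set_policy[OF that] by fastforce
qed (rule finite_states)

lemma step_eq:
  assumes "s \<in> states M"
  shows "step f s = (\<Sum>a\<in>actions M s. pmf (\<pi> s) a * measure_pmf.expectation (transition M s a) f)"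
  unfolding step_expectation[OF assms]
  using finite_set_transition[OF assms]
  by (subst pmf_expectation_bind[OF finite_actions[OF assms] _ set_policy[OF assms]]) auto

lemma total_reward_Cons: "total_reward M ((s, a) # h) = reward M (time s) (real_decision a) + total_reward M h"
  by (simp add: total_reward_def)

lemma finite_trajectory: "s \<in> states M \<Longrightarrow> finite (set_pmf (trajectory M \<pi> n s))"
proof (induction n arbitrary: s)
  case (Suc n)
  have "finite (set_pmf (\<pi> s))"
    using set_policy[OF Suc.prems] finite_actions[OF Suc.prems] finite_subset by blast
  moreover have "finite (set_pmf (transition M s a))" if "a \<in> set_pmf (\<pi> s)" for a
    using finite_set_transition[OF Suc.prems] set_policy[OF Suc.prems] that by blast
  moreover have "finite (set_pmf (trajectory M \<pi> n s'))"
    if "a \<in> set_pmf (\<pi> s)" "s' \<in> set_pmf (transition M s a)" for a s'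
    using Suc.IH set_transition[OF Suc.prems] set_policy[OF Suc.prems] that by blast
  ultimately show ?case by auto
qed simp

text \<open>Decomposition by the first step: the immediate reward is the summand
  \<open>k = 0\<close>, and applying \<open>step\<close> to the value of the remaining trajectory
  raises the other exponents by one.\<close>

lemma expectation_trajectory:
  assumes "s \<in> states M"
  shows "measure_pmf.expectation (trajectory M \<pi> n s) (total_reward M)
    = (\<Sum>k<n. (step ^^ k) expected_reward s)"
  using assms
proof (induction n arbitrary: s)
  case 0
  show ?case by (simp add: total_reward_def)
next
  case (Suc n)
  let ?V = "\<lambda>s. measure_pmf.expectation (trajectory M \<pi> n s) (total_reward M)"
  let ?r = "\<lambda>a. reward M (time s) (real_decision a)"
  have inner: "measure_pmf.expectation (bind_pmf (transition M s a) (\<lambda>s'.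
      map_pmf (\<lambda>h. (s, a) # h) (trajectory M \<pi> n s'))) (total_reward M)
    = ?r a + measure_pmf.expectation (transition M s a) ?V" if a: "a \<in> actions M s" for a
  proof -
    note tr = set_transition[OF Suc.prems a]
    have "measure_pmf.expectation (trajectory M \<pi> n s') (\<lambda>h. total_reward M ((s, a) # h)) = ?r a + ?V s'"
      if "s' \<in> states M" for s'
      using finite_trajectory[OF that, of n] by (simp add: total_reward_Cons integrable_measure_pmf_finite)
    then have "measure_pmf.expectation (bind_pmf (transition M s a) (\<lambda>s'.
        map_pmf (\<lambda>h. (s, a) # h) (trajectory M \<pi> n s'))) (total_reward M)
      = (\<Sum>s'\<in>states M. pmf (transition M s a) s' * (?r a + ?V s'))"
      using finite_trajectory tr
      by (subst pmf_expectation_bind[of "states M"]) (auto simp: finite_states intro!: sum.cong)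
    also have "\<dots> = (\<Sum>s'\<in>states M. pmf (transition M s a) s') * ?r a
        + (\<Sum>s'\<in>states M. pmf (transition M s a) s' * ?V s')"
      by (simp add: algebra_simps sum.distrib sum_distrib_left)
    also have "(\<Sum>s'\<in>states M. pmf (transition M s a) s') = 1"
      by (rule sum_pmf_eq_1[OF finite_states tr])
    also have "(\<Sum>s'\<in>states M. pmf (transition M s a) s' * ?V s')
        = measure_pmf.expectation (transition M s a) ?V"
      using tr by (subst integral_measure_pmf_real[OF finite_states]) (auto simp: mult.commute)
    finally show ?thesis by simp
  qed
  have fin: "finite (set_pmf (bind_pmf (transition M s a) (\<lambda>s'.
      map_pmf (\<lambda>h. (s, a) # h) (trajectory M \<pi> n s'))))" if "a \<in> actions M s" for a
    using finite_set_transition[OF Suc.prems that] set_transition[OF Suc.prems that] finite_trajectory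
    by auto
  have "measure_pmf.expectation (trajectory M \<pi> (Suc n) s) (total_reward M)
    = (\<Sum>a\<in>actions M s. pmf (\<pi> s) a * (?r a + measure_pmf.expectation (transition M s a) ?V))"
    unfolding trajectory.simps
    by (subst pmf_expectation_bind[OF finite_actions[OF Suc.prems] fin set_policy[OF Suc.prems]])
      (simp_all add: inner)
  also have "\<dots> = expected_reward s + step ?V s"
    by (simp add: step_eq[OF Suc.prems] expected_reward_def distrib_left sum.distrib)
  \<comment> \<open>The induction hypothesis holds on \<open>states M\<close> only, which is what
    \<open>step_cong\<close> asks for; the factor \<open>1\<close> fits the sum to
    \<open>step_sum\<close>.\<close>
  also have "step ?V s = step (\<lambda>s. \<Sum>k<n. 1 * (step ^^ k) expected_reward s) s"
    using Suc.IH by (intro fun_cong[OF step_cong]) simp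
  also have "\<dots> = (\<Sum>k<n. (step ^^ Suc k) expected_reward s)"
    by (subst step_sum) simp
  also have "expected_reward s + \<dots> = (\<Sum>k<Suc n. (step ^^ k) expected_reward s)"
    by (subst sum.lessThan_Suc_shift) simp
  finally show ?case .
qed

text \<open>\<open>D\<close> days comprise \<open>D * horizon M\<close> steps up to a bounded
  offset, so the daily mean tends to \<open>horizon M\<close> times the mean per step.\<close>

lemma average_reward_eq:
  assumes s: "s \<in> states M" and L: "(\<lambda>n. cesaro n expected_reward s) \<longlonglongrightarrow> L"
  shows "average_reward M \<pi> s = real (horizon M) * L"
proof -
  define n where "n D = D * horizon M + 1 - time s" for D
  have ts: "1 \<le> time s" "time s \<le> horizon M" using stateD(1)[OF s] by auto
  \<comment> \<open>The condition \<open>1 \<le> D\<close> makes the truncated subtraction in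
    \<open>n D\<close> exact.\<close>
  have n: "real (n D) = real D * real (horizon M) + (1 - real (time s))" if "1 \<le> D" for D
  proof -
    have "horizon M \<le> D * horizon M" using that by simp
    then have "time s \<le> D * horizon M + 1" using ts by linarith
    then show ?thesis by (simp add: n_def of_nat_diff)
  qed
  have "filterlim n at_top sequentially"
  proof (rule filterlim_at_top_mono)
    show "filterlim (\<lambda>D::nat. D - 1) at_top sequentially"
      by (rule filterlim_minus_const_nat_at_top)
    show "\<forall>\<^sub>F D in sequentially. D - 1 \<le> n D"
    proof (intro always_eventually allI)
      fix D
      show "D - 1 \<le> n D"
      proof (cases D)
        case (Suc m)
        have "m * 1 \<le> m * horizon M" using horizon_ge_1 by (intro mult_le_mono2)
        then show ?thesis unfolding n_def Suc mult_Suc using ts by linarith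
      qed simp
    qed
  qed
  then have 1: "(\<lambda>D. cesaro (n D) expected_reward s) \<longlonglongrightarrow> L"
    by (rule filterlim_compose[OF L])
  have "(\<lambda>D. real (horizon M) + (1 - real (time s)) / real D) \<longlonglongrightarrow> real (horizon M) + 0"
    by (intro tendsto_add tendsto_const tendsto_divide_0[OF tendsto_const]
        filterlim_at_top_imp_at_infinity filterlim_real_sequentially)
  then have 2: "(\<lambda>D. (real (horizon M) + (1 - real (time s)) / real D) * cesaro (n D) expected_reward s)
      \<longlonglongrightarrow> real (horizon M) * L"
    using tendsto_mult[OF _ 1] by fastforce
  have "1 / real D * measure_pmf.expectation (trajectory M \<pi> (n D) s) (total_reward M)
      = (real (horizon M) + (1 - real (time s)) / real D) * cesaro (n D) expected_reward s" if "1 \<le> D" for D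
  proof (cases "n D = 0")
    case True
    then show ?thesis by (simp add: cesaro_def total_reward_def)
  next
    case False
    have "real (horizon M) + (1 - real (time s)) / real D = real (n D) / real D"
      using that by (simp add: n[OF that] field_simps)
    then show ?thesis using False
      by (simp add: expectation_trajectory[OF s] cesaro_def)
  qed
  then have "\<forall>\<^sub>F D in sequentially. (real (horizon M) + (1 - real (time s)) / real D) * cesaro (n D) expected_reward s
      = 1 / real D * measure_pmf.expectation (trajectory M \<pi> (n D) s) (total_reward M)"
    by (intro eventually_mono[OF eventually_ge_at_top[of 1]]) simp
  then have "(\<lambda>D. 1 / real D * measure_pmf.expectation (trajectory M \<pi> (n D) s) (total_reward M))
      \<longlonglongrightarrow> real (horizon M) * L"
    by (rule Lim_transform_eventually[OF 2])
  then show ?thesis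
    unfolding average_reward_def n_def by (rule limI)
qed

end

subsection \<open>The fluid solution of an invariant measure\<close>

text \<open>Stationarity is stated in weak form, by testing against functions; the Cesaro limits
  deliver it in this form, and it is applied to counts of the state.\<close>

locale occupation = robotaxi_policy +
  fixes \<mu> :: "'a state \<Rightarrow> real"
  assumes \<mu>_nonneg: "s \<in> states M \<Longrightarrow> 0 \<le> \<mu> s"
    and sum_\<mu>: "(\<Sum>s\<in>states M. \<mu> s) = 1"
    and \<mu>_step: "(\<Sum>s\<in>states M. \<mu> s * step f s) = (\<Sum>s\<in>states M. \<mu> s * f s)"
begin

text \<open>Daily mean per vehicle of \<open>h\<close> over the state-action pairs at time \<open>t\<close>, in the stationary regime;
  the factor \<open>horizon M\<close> is there since \<open>\<mu>\<close> spreads its mass over all times of the day.\<close>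

definition occ :: "nat \<Rightarrow> ('a state \<Rightarrow> 'a action \<Rightarrow> real) \<Rightarrow> real" where
  "occ t h = real (horizon M) / real (fleet M) *
    (\<Sum>s\<in>states M. \<Sum>a\<in>actions M s. \<mu> s * pmf (\<pi> s) a * (if time s = t then h s a else 0))"

lemma occ_mono:
  assumes "\<And>s a. s \<in> states M \<Longrightarrow> a \<in> actions M s \<Longrightarrow> time s = t \<Longrightarrow> h s a \<le> h' s a"
  shows "occ t h \<le> occ t h'"
  unfolding occ_def
  by (intro mult_left_mono sum_mono) (simp_all add: assms \<mu>_nonneg)

lemma occ_cong:
  assumes "\<And>s a. s \<in> states M \<Longrightarrow> a \<in> actions M s \<Longrightarrow> time s = t \<Longrightarrow> h s a = h' s a"
  shows "occ t h = occ t h'"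
  by (intro antisym occ_mono) (simp_all add: assms)

lemma occ_scale: "occ t (\<lambda>s a. c * h s a) = c * occ t h"
proof -
  have "(\<Sum>s\<in>states M. \<Sum>a\<in>actions M s. \<mu> s * pmf (\<pi> s) a * (if time s = t then c * h s a else 0))
      = c * (\<Sum>s\<in>states M. \<Sum>a\<in>actions M s. \<mu> s * pmf (\<pi> s) a * (if time s = t then h s a else 0))"
    by (auto simp: sum_distrib_left algebra_simps intro!: sum.cong)
  then show ?thesis by (simp add: occ_def)
qed

lemma occ_zero: "occ t (\<lambda>s a. 0) = 0"
  using occ_scale[of t 0 "\<lambda>s a. 0"] by simp

lemma occ_nonneg:
  "(\<And>s a. s \<in> states M \<Longrightarrow> a \<in> actions M s \<Longrightarrow> time s = t \<Longrightarrow> 0 \<le> h s a) \<Longrightarrow> 0 \<le> occ t h"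
  using occ_mono[of t "\<lambda>s a. 0" h] by (simp add: occ_zero)

lemma occ_eq_0:
  "(\<And>s a. s \<in> states M \<Longrightarrow> a \<in> actions M s \<Longrightarrow> time s = t \<Longrightarrow> h s a = 0) \<Longrightarrow> occ t h = 0"
  using occ_cong[of t h "\<lambda>s a. 0"] by (simp add: occ_zero)

lemma occ_add: "occ t (\<lambda>s a. g s a + h s a) = occ t g + occ t h"
proof -
  have "(\<Sum>s\<in>states M. \<Sum>a\<in>actions M s. \<mu> s * pmf (\<pi> s) a * (if time s = t then g s a + h s a else 0))
      = (\<Sum>s\<in>states M. \<Sum>a\<in>actions M s. \<mu> s * pmf (\<pi> s) a * (if time s = t then g s a else 0))
      + (\<Sum>s\<in>states M. \<Sum>a\<in>actions M s. \<mu> s * pmf (\<pi> s) a * (if time s = t then h s a else 0))"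
    unfolding sum.distrib[symmetric] by (auto simp: algebra_simps intro!: sum.cong)
  then show ?thesis by (simp add: occ_def algebra_simps)
qed

lemma occ_diff: "occ t (\<lambda>s a. g s a - h s a) = occ t g - occ t h"
  using occ_add[of t "\<lambda>s a. g s a - h s a" h] by simp

lemma occ_sum: "occ t (\<lambda>s a. \<Sum>i\<in>I. h i s a) = (\<Sum>i\<in>I. occ t (h i))"
  by (induction I rule: infinite_finite_induct) (simp_all add: occ_zero occ_add)

lemma occ_if: "occ t (\<lambda>s a. if P then h s a else 0) = (if P then occ t h else 0)"
  by (simp add: occ_zero)

lemma occ_state_function:
  "occ t (\<lambda>s a. g s) = real (horizon M) / real (fleet M) * (\<Sum>s\<in>states M. \<mu> s * (if time s = t then g s else 0))"
proof -
  have "(\<Sum>a\<in>actions M s. \<mu> s * pmf (\<pi> s) a * (if time s = t then g s else 0))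
      = \<mu> s * (if time s = t then g s else 0)" if "s \<in> states M" for s
  proof -
    have "(\<Sum>a\<in>actions M s. \<mu> s * pmf (\<pi> s) a * (if time s = t then g s else 0))
        = \<mu> s * (if time s = t then g s else 0) * (\<Sum>a\<in>actions M s. pmf (\<pi> s) a)"
      by (simp add: sum_distrib_left algebra_simps)
    then show ?thesis by (simp add: sum_policy[OF that])
  qed
  then show ?thesis by (simp add: occ_def)
qed

text \<open>Stationarity applied to \<open>g\<close> restricted to one time of day. The clock
  advances deterministically, so one step earlier the restricted function is again supported on a
  single time, the preceding one.\<close>

lemma occ_shift_expectation:
  "occ (day_time M (i + 1)) (\<lambda>s a. g s)
    = occ (day_time M i) (\<lambda>s a. measure_pmf.expectation (transition M s a) g)"
proof -
  define t where "t = day_time M i"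
  define t' where "t' = day_time M (i + 1)"
  have t: "t \<in> {1..horizon M}" and t': "t' \<in> {1..horizon M}" "t' = day_time M (int t + 1)"
    unfolding t_def t'_def by (rule day_time_range day_time_add[symmetric])+
  let ?f = "\<lambda>s. if time s = t' then g s else 0"
  have "measure_pmf.expectation (transition M s a) ?f
      = (if time s = t then measure_pmf.expectation (transition M s a) g else 0)"
    if s: "s \<in> states M" for s a
  proof -
    have "day_time M (int (time s) + 1) = t' \<longleftrightarrow> time s = t"
      using day_time_Suc_eq_iff[OF stateD(1)[OF s] t'(1)] day_time_Suc_eq_iff[OF t t'(1)] t'(2) by simp
    then show ?thesis by (simp add: transition_def next_state_def)
  qed
  then have step: "step ?f s = (\<Sum>a\<in>actions M s. pmf (\<pi> s) a *
      (if time s = t then measure_pmf.expectation (transition M s a) g else 0))" if "s \<in> states M" for s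
    using that by (simp add: step_eq)
  have "(\<Sum>s\<in>states M. \<mu> s * ?f s) = (\<Sum>s\<in>states M. \<mu> s * step ?f s)"
    by (rule \<mu>_step[symmetric])
  also have "\<dots> = (\<Sum>s\<in>states M. \<Sum>a\<in>actions M s. \<mu> s * pmf (\<pi> s) a *
      (if time s = t then measure_pmf.expectation (transition M s a) g else 0))"
    by (simp add: step sum_distrib_left mult.assoc)
  finally show ?thesis
    unfolding occ_state_function t_def[symmetric] t'_def[symmetric] by (simp add: occ_def)
qed

text \<open>Meant for components whose next value does not depend on the arriving requests:
  vehicles, chargers, and trips that have already waited.\<close>

lemma occ_shift:
  assumes "\<And>s a X. s \<in> states M \<Longrightarrow> a \<in> actions M s \<Longrightarrow> time s = day_time M i \<Longrightarrow>
    g (next_state M s a X) = h s a"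
  shows "occ (day_time M (i + 1)) (\<lambda>s a. g s) = occ (day_time M i) h"
  unfolding occ_shift_expectation
  by (rule occ_cong) (simp add: transition_def assms)

text \<open>The clock moves cyclically, so invariance gives all times of day the same share of the
  total mass \<open>1\<close>; the normalisation of \<open>occ\<close> turns this share
  \<open>1 / horizon M\<close> into the stated value.\<close>

lemma occ_one: "t \<in> {1..horizon M} \<Longrightarrow> occ t (\<lambda>s a. 1) = 1 / real (fleet M)"
proof -
  assume t: "t \<in> {1..horizon M}"
  define c where "c = occ 1 (\<lambda>s a. 1)"
  have const: "occ t (\<lambda>s a. 1) = c" if "t \<in> {1..horizon M}" for t
    using that
  proof (induction t)
    case (Suc t)
    show ?case
    proof (cases "t = 0")
      case False
      then have "t \<in> {1..horizon M}" using Suc.prems by auto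
      moreover have "occ (day_time M (int t + 1)) (\<lambda>s a. 1) = occ (day_time M (int t)) (\<lambda>s a. 1)"
        by (rule occ_shift) simp
      moreover have "day_time M (int t + 1) = Suc t"
        using day_time_id[OF Suc.prems] by (simp add: add.commute)
      ultimately show ?thesis using Suc.IH day_time_id by simp
    qed (simp add: c_def)
  qed simp
  have "real (horizon M) * c = (\<Sum>t=1..horizon M. occ t (\<lambda>s a. 1))"
    using const by simp
  also have "\<dots> = real (horizon M) / real (fleet M) *
      (\<Sum>s\<in>states M. \<Sum>t=1..horizon M. \<mu> s * (if time s = t then 1 else 0))"
    unfolding occ_state_function by (subst sum.swap) (simp only: sum_distrib_left)
  also have "(\<Sum>s\<in>states M. \<Sum>t=1..horizon M. \<mu> s * (if time s = t then 1 else 0)) = (\<Sum>s\<in>states M. \<mu> s)"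
  proof (rule sum.cong[OF refl])
    fix s assume "s \<in> states M"
    from stateD(1)[OF this] show "(\<Sum>t=1..horizon M. \<mu> s * (if time s = t then 1 else 0)) = \<mu> s"
      by (simp flip: sum_distrib_left)
  qed
  finally have "real (horizon M) * c = real (horizon M) * (1 / real (fleet M))"
    by (simp add: sum_\<mu>)
  then have "c = 1 / real (fleet M)"
    using horizon_ge_1 by (subst (asm) mult_cancel_left) simp
  then show ?thesis by (simp add: const[OF t])
qed

section \<open>Constraints and objective of the linear program at the stationary means\<close>

definition fluid :: "nat \<Rightarrow> ('a, real) decision" where
  "fluid t = \<lparr>fulfil = \<lambda>c k. occ t (\<lambda>s a. real (fulfil a c k)),
     reposition = \<lambda>c v. occ t (\<lambda>s a. real (reposition a c v)),
     charge = \<lambda>c \<delta>. occ t (\<lambda>s a. real (charge a c \<delta>)),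
     pass = \<lambda>c. occ t (\<lambda>s a. real (pass a c))\<rparr>"

lemma fluid_simps:
  "fulfil (fluid t) c k = occ t (\<lambda>s a. real (fulfil a c k))"
  "reposition (fluid t) c v = occ t (\<lambda>s a. real (reposition a c v))"
  "charge (fluid t) c \<delta> = occ t (\<lambda>s a. real (charge a c \<delta>))"
  "pass (fluid t) c = occ t (\<lambda>s a. real (pass a c))"
  by (simp_all add: fluid_def)

lemma decision_total_fluid: "decision_total M (fluid t) c = occ t (\<lambda>s a. real (decision_total M a c))"
  by (simp add: decision_total_def fluid_simps occ_add occ_sum)

lemma flow_fluid: "flow M t' (fluid t) c = occ t (\<lambda>s a. real (flow M t' a c))"
  by (cases c) (simp only: flow.simps fluid_simps of_nat_add of_nat_sum occ_add occ_sum
      if_distrib[of real] of_nat_0 occ_if)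

lemma reward_fluid: "reward M t' (fluid t) = occ t (\<lambda>s a. reward M t' (real_decision a))"
  by (simp add: reward_def real_decision_def fluid_simps occ_add occ_sum occ_scale)

text \<open>Both sides are the normalised mean number of vehicles of status \<open>c\<close> at time
  \<open>t\<close>: on the left by the transition from the preceding step, on the right because an
  action assigns every vehicle exactly once.\<close>

lemma fluid_flow_balance:
  assumes "t \<in> {1..horizon M}" "c \<in> vehicle_statuses M"
  shows "flow M (day_time M (int t - 1)) (fluid (day_time M (int t - 1))) c = decision_total M (fluid t) c"
proof -
  have "occ (day_time M (int t - 1 + 1)) (\<lambda>s a. real (vehicles s c))
      = occ (day_time M (int t - 1)) (\<lambda>s a. real (flow M (day_time M (int t - 1)) a c))"
    using assms(2) by (intro occ_shift) (simp add: next_state_def)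
  also have "day_time M (int t - 1 + 1) = t"
    using day_time_id[OF assms(1)] by simp
  also have "occ t (\<lambda>s a. real (vehicles s c)) = occ t (\<lambda>s a. real (decision_total M a c))"
    using actionD(5)[OF _ assms(2)] by (intro occ_cong) simp
  finally show ?thesis by (simp add: flow_fluid decision_total_fluid)
qed

text \<open>The requests from \<open>u\<close> to \<open>v\<close> arriving at time \<open>t\<close> are served at the times \<open>t + \<xi>\<close> with
  \<open>\<xi> \<le> conn_patience M\<close>; the loss of unserved ones along the way telescopes.\<close>

lemma fluid_trips:
  assumes t: "t \<in> {1..horizon M}" and uv: "u \<in> regions M" "v \<in> regions M"
  shows "(\<Sum>\<eta>\<le>max_task M u. \<Sum>b\<le>range_max M. \<Sum>\<xi>\<le>conn_patience M.
      fulfil (fluid (day_time M (int t + int \<xi>))) (u, \<eta>, b) (u, v, \<xi>)) \<le> 1 / real (fleet M) * demand M u v t"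
proof -
  \<comment> \<open>\<open>D \<xi>\<close> is the time at which requests that arrived at time
    \<open>t\<close> have waited \<xi> steps; in the mean, \<open>G\<close> counts those still
    waiting and \<open>F\<close> those assigned then.\<close>
  define D where "D \<xi> = day_time M (int t + int \<xi>)" for \<xi>
  define G where "G \<xi> = occ (D \<xi>) (\<lambda>s a. real (trips s (u, v, \<xi>)))" for \<xi>
  define F where "F \<xi> = occ (D \<xi>) (\<lambda>s a. real (\<Sum>c\<in>vehicle_statuses M. fulfil a c (u, v, \<xi>)))" for \<xi>
  have mem: "(u, v, \<xi>) \<in> trip_statuses M" if "\<xi> \<le> conn_patience M" for \<xi>
    using that uv by (simp add: trip_statuses_def)
  have FG: "F \<xi> \<le> G \<xi>" if "\<xi> \<le> conn_patience M" for \<xi>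
    unfolding F_def G_def using actionD(6)[OF _ mem[OF that]] by (intro occ_mono) (simp only: of_nat_le_iff)
  have Suc: "G (Suc \<xi>) = G \<xi> - F \<xi>" if "Suc \<xi> \<le> conn_patience M" for \<xi>
  proof -
    have "G (Suc \<xi>) = occ (day_time M (int t + int \<xi> + 1)) (\<lambda>s a. real (trips s (u, v, Suc \<xi>)))"
      by (simp add: G_def D_def algebra_simps)
    also have "\<dots> = occ (D \<xi>) (\<lambda>s a. real (trips s (u, v, \<xi>))
        - real (\<Sum>c\<in>vehicle_statuses M. fulfil a c (u, v, \<xi>)))"
      unfolding D_def
    proof (rule occ_shift)
      fix s a X assume a: "a \<in> actions M s"
      \<comment> \<open>This bound turns the natural subtraction in \<open>next_state\<close> into a
        real difference.\<close>
      have "(\<Sum>c\<in>vehicle_statuses M. fulfil a c (u, v, \<xi>)) \<le> trips s (u, v, \<xi>)"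
        using that by (intro actionD(6)[OF a] mem) simp
      then show "real (trips (next_state M s a X) (u, v, Suc \<xi>)) = real (trips s (u, v, \<xi>))
          - real (\<Sum>c\<in>vehicle_statuses M. fulfil a c (u, v, \<xi>))"
        using mem[OF that] by (simp add: next_state_def del: of_nat_sum)
    qed
    finally show ?thesis by (simp only: occ_diff G_def F_def)
  qed
  \<comment> \<open>Telescoping stops at the last admissible waiting time, where
    \<open>F \<le> G\<close> closes the estimate: what then remains of \<open>G\<close> leaves the
    system.\<close>
  have "(\<Sum>\<xi><n. F \<xi>) = G 0 - G n" if "n \<le> conn_patience M" for n
    using that by (induction n) (simp_all add: Suc)
  from this[of "conn_patience M"] FG[of "conn_patience M"]
  have FG0: "(\<Sum>\<xi>\<le>conn_patience M. F \<xi>) \<le> G 0"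
    by (simp add: lessThan_Suc_atMost[symmetric])
  have "G 0 = occ (day_time M (int t - 1 + 1)) (\<lambda>s a. real (trips s (u, v, 0)))"
    by (simp add: G_def D_def)
  also have "\<dots> \<le> occ (day_time M (int t - 1)) (\<lambda>s a. demand M u v t * 1)"
    unfolding occ_shift_expectation
  proof (rule occ_mono)
    fix s :: "'a state" and a :: "'a action"
    assume "time s = day_time M (int t - 1)"
    then have ts: "day_time M (int (time s) + 1) = t"
      using day_time_add[of "int t - 1" 1] day_time_id[OF t] by simp
    let ?P = "Pi_pmf (regions M \<times> regions M) 0 (\<lambda>(u, v). requests_pmf (demand M u v t))"
    let ?K = "fleet M * (conn_patience M + 1)"
    have "measure_pmf.expectation (transition M s a) (\<lambda>s'. real (trips s' (u, v, 0)))
        = measure_pmf.expectation ?P (\<lambda>X. real (min (X (u, v)) ?K))"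
      using mem[of 0] by (simp add: transition_def next_state_def ts)
    also have "\<dots> = measure_pmf.expectation (map_pmf (\<lambda>X. X (u, v)) ?P) (\<lambda>n. real (min n ?K))"
      by simp
    also have "\<dots> = measure_pmf.expectation (requests_pmf (demand M u v t)) (\<lambda>n. real (min n ?K))"
      using finite_regions uv by (subst Pi_pmf_component) simp_all
    also have "\<dots> \<le> demand M u v t"
      by (rule expectation_min_requests_le[OF demand_nonneg[OF uv t]])
    finally show "measure_pmf.expectation (transition M s a) (\<lambda>s'. real (trips s' (u, v, 0)))
        \<le> demand M u v t * 1" by simp
  qed
  also have "\<dots> = 1 / real (fleet M) * demand M u v t"
    by (subst occ_scale) (simp only: occ_one[OF day_time_range] mult.commute)
  finally have G0: "G 0 \<le> 1 / real (fleet M) * demand M u v t" .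
  have "(\<Sum>\<eta>\<le>max_task M u. \<Sum>b\<le>range_max M. \<Sum>\<xi>\<le>conn_patience M. fulfil (fluid (D \<xi>)) (u, \<eta>, b) (u, v, \<xi>))
      = (\<Sum>\<xi>\<le>conn_patience M. \<Sum>\<eta>\<le>max_task M u. \<Sum>b\<le>range_max M. fulfil (fluid (D \<xi>)) (u, \<eta>, b) (u, v, \<xi>))"
    by (rule sum_push2[symmetric])
  \<comment> \<open>\<open>F\<close> sums over vehicles of all regions and the left side over those
    of \<open>u\<close>, so nonnegativity of the entries gives the inequality.\<close>
  also have "\<dots> \<le> (\<Sum>\<xi>\<le>conn_patience M. F \<xi>)"
  proof (rule sum_mono)
    fix \<xi>
    have "(\<Sum>\<eta>\<le>max_task M u. \<Sum>b\<le>range_max M. fulfil (fluid (D \<xi>)) (u, \<eta>, b) (u, v, \<xi>))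
      = occ (D \<xi>) (\<lambda>s a. real (\<Sum>\<eta>\<le>max_task M u. \<Sum>b\<le>range_max M. fulfil a (u, \<eta>, b) (u, v, \<xi>)))"
      by (simp add: fluid_simps occ_sum)
    also have "\<dots> \<le> F \<xi>"
      unfolding F_def sum_vehicle_statuses of_nat_le_iff using finite_regions uv
      by (intro occ_mono of_nat_mono member_le_sum[where
          f = "\<lambda>u'. \<Sum>\<eta>\<le>max_task M u'. \<Sum>b\<le>range_max M. fulfil _ (u', \<eta>, b) (u, v, \<xi>)"]) auto
    finally show "(\<Sum>\<eta>\<le>max_task M u. \<Sum>b\<le>range_max M. fulfil (fluid (D \<xi>)) (u, \<eta>, b) (u, v, \<xi>)) \<le> F \<xi>" .
  qed
  finally show ?thesis using FG0 G0 by (simp only: D_def)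
qed

text \<open>A charger occupied for \<open>j\<close> steps shows up as one that becomes available in \<open>charge_period M - j\<close> steps.\<close>

lemma occ_avail:
  assumes v: "v \<in> regions M" "\<delta> \<in> rates M" and "Suc j < charge_period M"
  shows "occ (day_time M i) (\<lambda>s a. real (avail s (v, \<delta>, charge_period M - Suc j)))
    = occ (day_time M (i - int (Suc j))) (\<lambda>s a. real (\<Sum>b\<le>range_max M. charge a (v, 0, b) \<delta>))"
  using assms(3)
proof (induction j arbitrary: i)
  case 0
  have "occ (day_time M (i - 1 + 1)) (\<lambda>s a. real (avail s (v, \<delta>, charge_period M - Suc 0)))
    = occ (day_time M (i - 1)) (\<lambda>s a. real (\<Sum>b\<le>range_max M. charge a (v, 0, b) \<delta>))"
    using 0 v by (intro occ_shift) (simp add: next_state_def charger_statuses_def)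
  then show ?case by simp
next
  case (Suc j)
  have J: "charge_period M - Suc (Suc j) \<noteq> 0" "charge_period M - Suc (Suc j) \<noteq> charge_period M - 1"
    "charge_period M \<noteq> 1" "charge_period M - Suc (Suc j) + 1 = charge_period M - Suc j"
    using Suc.prems by auto
  have mem: "(v, \<delta>, charge_period M - Suc (Suc j)) \<in> charger_statuses M"
    using v Suc.prems by (simp add: charger_statuses_def)
  have "occ (day_time M (i - 1 + 1)) (\<lambda>s a. real (avail s (v, \<delta>, charge_period M - Suc (Suc j))))
    = occ (day_time M (i - 1)) (\<lambda>s a. real (avail s (v, \<delta>, charge_period M - Suc j)))"
    by (rule occ_shift) (simp only: next_state_def state.simps prod.case mem J if_False not_True_eq_False)
  also have "\<dots> = occ (day_time M (i - 1 - int (Suc j))) (\<lambda>s a. real (\<Sum>b\<le>range_max M. charge a (v, 0, b) \<delta>))"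
    using Suc.prems by (intro Suc.IH) simp
  finally show ?case by (simp add: algebra_simps)
qed

text \<open>At time \<open>t\<close> a charger engaged \<open>j \<ge> 1\<close> steps ago has
  remaining time \<open>charge_period M - j\<close>, so the summands with \<open>j \<ge> 1\<close>
  exhaust the busy chargers, while those engaged now are among the free ones. Together they are at
  most all chargers of the region and rate.\<close>

lemma fluid_chargers:
  assumes t: "t \<in> {1..horizon M}" and v: "v \<in> regions M" "\<delta> \<in> rates M"
  shows "(\<Sum>j<charge_period M. \<Sum>b\<le>range_max M. charge (fluid (day_time M (int t - int j))) (v, 0, b) \<delta>)
    \<le> 1 / real (fleet M) * real (chargers M v \<delta>)"
proof -
  define Q where "Q j = occ (day_time M (int t - int j)) (\<lambda>s a. real (\<Sum>b\<le>range_max M. charge a (v, 0, b) \<delta>))" for j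
  obtain n where n: "charge_period M = Suc n" using charge_period_pos by (cases "charge_period M") auto
  have t_eq: "day_time M (int t) = t" by (rule day_time_id[OF t])
  have "(\<Sum>j<charge_period M. \<Sum>b\<le>range_max M. charge (fluid (day_time M (int t - int j))) (v, 0, b) \<delta>)
      = (\<Sum>j<charge_period M. Q j)"
    by (simp add: Q_def fluid_simps occ_sum)
  also have "\<dots> = Q 0 + (\<Sum>j<n. Q (Suc j))"
    unfolding n by (rule sum.lessThan_Suc_shift)
  also have "(\<Sum>j<n. Q (Suc j)) = (\<Sum>j<n. occ t (\<lambda>s a. real (avail s (v, \<delta>, Suc (n - Suc j)))))"
  proof (rule sum.cong[OF refl])
    fix j assume "j \<in> {..<n}"
    then have "Suc j < charge_period M" "charge_period M - Suc j = Suc (n - Suc j)" by (auto simp: n)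
    with occ_avail[OF v this(1), of "int t"]
    show "Q (Suc j) = occ t (\<lambda>s a. real (avail s (v, \<delta>, Suc (n - Suc j))))"
      by (simp only: Q_def t_eq)
  qed
  \<comment> \<open>Reverses the order of summation: the most recent starts have the longest
    remaining times.\<close>
  also have "\<dots> = (\<Sum>j<n. occ t (\<lambda>s a. real (avail s (v, \<delta>, Suc j))))"
    by (rule sum.nat_diff_reindex)
  also have "Q 0 \<le> occ t (\<lambda>s a. real (avail s (v, \<delta>, 0)))"
    unfolding Q_def using sum_charge_le_avail[OF _ v]
    by (simp only: of_nat_0 diff_0_right t_eq) (intro occ_mono of_nat_mono)
  also have "occ t (\<lambda>s a. real (avail s (v, \<delta>, 0))) + (\<Sum>j<n. occ t (\<lambda>s a. real (avail s (v, \<delta>, Suc j))))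
      = occ t (\<lambda>s a. real (\<Sum>j<charge_period M. avail s (v, \<delta>, j)))"
    unfolding n by (simp only: sum.lessThan_Suc_shift of_nat_add of_nat_sum occ_add occ_sum)
  also have "\<dots> = occ t (\<lambda>s a. real (chargers M v \<delta>) * 1)"
    using stateD(3)[OF _ v] by (intro occ_cong) simp
  also have "\<dots> = 1 / real (fleet M) * real (chargers M v \<delta>)"
    by (subst occ_scale) (simp only: occ_one[OF t] mult.commute)
  finally show ?thesis by simp
qed

lemma fluid_in_fluid_feasible: "fluid \<in> fluid_feasible M"
proof -
  have 1: "fulfil (fluid t) (u, \<eta>, b) (u, v, \<xi>) = 0" if "b < consumption M u v" for t u \<eta> b v \<xi>
    unfolding fluid_simps using actionD(1)[of _ _ u \<eta> b u v \<xi>] that by (intro occ_eq_0) fastforce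
  have 2: "reposition (fluid t) (u, \<eta>, b) v = 0" if "b < consumption M u v" for t u \<eta> b v
    unfolding fluid_simps using actionD(2)[of _ _ u \<eta> b v] that by (intro occ_eq_0) fastforce
  have 3: "(\<Sum>c\<in>vehicle_statuses M. decision_total M (fluid t) c) = 1" if "t \<in> {1..horizon M}" for t
  proof -
    have "(\<Sum>c\<in>vehicle_statuses M. decision_total M (fluid t) c)
        = occ t (\<lambda>s a. real (\<Sum>c\<in>vehicle_statuses M. decision_total M a c))"
      by (simp add: decision_total_fluid occ_sum)
    \<comment> \<open>Every vehicle is counted once, so the total is the fleet size, which the value
      of \<open>occ_one\<close> cancels.\<close>
    also have "\<dots> = occ t (\<lambda>s a. real (fleet M) * 1)"
      using stateD(2) by (intro occ_cong) (simp add: actionD(5) cong: sum.cong del: of_nat_sum)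
    also have "\<dots> = 1"
      using fleet_ge_1 by (subst occ_scale) (simp add: occ_one[OF that])
    finally show ?thesis .
  qed
  have 4: "0 \<le> fulfil (fluid t) c k" "0 \<le> reposition (fluid t) c v" "0 \<le> charge (fluid t) c \<delta>"
    "0 \<le> pass (fluid t) c" for t c k v \<delta>
    unfolding fluid_simps by (intro occ_nonneg of_nat_0_le_iff)+
  show ?thesis
    unfolding fluid_feasible_def
    by (intro CollectI conjI ballI allI impI fluid_flow_balance fluid_trips fluid_chargers 1 2 3 4; assumption)
qed

text \<open>Each state belongs to exactly one time of day, so the slices of \<open>occ\<close> add
  up to the mean under \<mu>. The factor \<open>fleet M\<close> of the objective cancels the
  division in \<open>occ\<close>, and \<open>horizon M\<close> remains.\<close>

lemma fluid_objective_fluid: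
  "fluid_objective M fluid = real (horizon M) * (\<Sum>s\<in>states M. \<mu> s * expected_reward s)"
proof -
  have "(\<Sum>t=1..horizon M. reward M t (fluid t))
      = (\<Sum>t=1..horizon M. occ t (\<lambda>s a. reward M (time s) (real_decision a)))"
    unfolding reward_fluid by (intro sum.cong refl occ_cong) simp
  also have "\<dots> = real (horizon M) / real (fleet M) * (\<Sum>t=1..horizon M. \<Sum>s\<in>states M. \<Sum>a\<in>actions M s.
      \<mu> s * pmf (\<pi> s) a * (if time s = t then reward M (time s) (real_decision a) else 0))"
    unfolding occ_def by (rule sum_distrib_left[symmetric])
  also have "(\<Sum>t=1..horizon M. \<Sum>s\<in>states M. \<Sum>a\<in>actions M s.
      \<mu> s * pmf (\<pi> s) a * (if time s = t then reward M (time s) (real_decision a) else 0))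
    = (\<Sum>s\<in>states M. \<Sum>a\<in>actions M s. \<Sum>t=1..horizon M.
      \<mu> s * pmf (\<pi> s) a * (if time s = t then reward M (time s) (real_decision a) else 0))"
    by (subst sum.swap, rule sum.cong[OF refl], rule sum.swap)
  also have "(\<Sum>s\<in>states M. \<Sum>a\<in>actions M s. \<Sum>t=1..horizon M.
      \<mu> s * pmf (\<pi> s) a * (if time s = t then reward M (time s) (real_decision a) else 0))
    = (\<Sum>s\<in>states M. \<mu> s * expected_reward s)"
    unfolding expected_reward_def sum_distrib_left
  proof (intro sum.cong refl)
    fix s a assume "s \<in> states M"
    from stateD(1)[OF this] show "(\<Sum>t=1..horizon M. \<mu> s * pmf (\<pi> s) a *
        (if time s = t then reward M (time s) (real_decision a) else 0))
      = \<mu> s * (pmf (\<pi> s) a * reward M (time s) (real_decision a))"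
      by (simp flip: sum_distrib_left)
  qed
  finally show ?thesis using fleet_ge_1 by (simp add: fluid_objective_def)
qed

end

section \<open>Boundedness of the linear program and comparison of the two values\<close>

context robotaxi
begin

text \<open>Required for the real supremum \<open>fluid_value\<close> to be an upper bound.
  Repositioning and charging contribute nonpositive amounts, and total mass \<open>1\<close> at each
  time limits every trip entry to \<open>1\<close>, so the fulfilment rewards themselves provide the
  bound.\<close>

lemma fluid_objective_bdd_above: "bdd_above (fluid_objective M ` fluid_feasible M)"
proof (rule bdd_aboveI2)
  fix x assume x: "x \<in> fluid_feasible M"
  have reward_le: "reward M t (x t) \<le> (\<Sum>c\<in>vehicle_statuses M. \<Sum>u\<in>regions M. \<Sum>v\<in>regions M.
      \<Sum>\<xi>\<le>conn_patience M. fulfil_reward M u v t)" (is "_ \<le> ?B t") if t: "t \<in> {1..horizon M}" for t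
  proof -
    have total: "(\<Sum>c\<in>vehicle_statuses M. decision_total M (x t) c) = 1"
      using x t unfolding fluid_feasible_def by blast
    have "\<forall>c\<in>vehicle_statuses M. (\<forall>k\<in>trip_statuses M. 0 \<le> fulfil (x t) c k) \<and>
        (\<forall>v\<in>regions M. 0 \<le> reposition (x t) c v) \<and>
        (\<forall>\<delta>\<in>rates M. 0 \<le> charge (x t) c \<delta>) \<and> 0 \<le> pass (x t) c"
      using x t unfolding fluid_feasible_def by blast
    then have nonneg: "0 \<le> pass (x t) c" "k \<in> trip_statuses M \<Longrightarrow> 0 \<le> fulfil (x t) c k"
      "v \<in> regions M \<Longrightarrow> 0 \<le> reposition (x t) c v" "\<delta> \<in> rates M \<Longrightarrow> 0 \<le> charge (x t) c \<delta>"
      if "c \<in> vehicle_statuses M" for c k v \<delta>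
      using that by blast+
    have le_1: "fulfil (x t) c k \<le> 1" if c: "c \<in> vehicle_statuses M" and k: "k \<in> trip_statuses M" for c k
    proof -
      have "fulfil (x t) c k \<le> (\<Sum>k\<in>trip_statuses M. fulfil (x t) c k)"
        using nonneg(2)[OF c] k by (intro member_le_sum) auto
      also have "\<dots> \<le> decision_total M (x t) c"
        unfolding decision_total_def using nonneg[OF c] by (simp add: sum_nonneg)
      also have "\<dots> \<le> (\<Sum>c\<in>vehicle_statuses M. decision_total M (x t) c)"
        using c nonneg
        by (intro member_le_sum[where f = "decision_total M (x t)"])
          (auto simp: decision_total_def intro!: add_nonneg_nonneg sum_nonneg)
      finally show ?thesis using total by simp
    qed
    have "(\<Sum>c\<in>vehicle_statuses M. \<Sum>u\<in>regions M. \<Sum>v\<in>regions M. \<Sum>\<xi>\<le>conn_patience M.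
        fulfil_reward M u v t * fulfil (x t) c (u, v, \<xi>)) \<le> ?B t"
    proof (intro sum_mono)
      fix c u v \<xi> assume "c \<in> vehicle_statuses M" "u \<in> regions M" "v \<in> regions M" "\<xi> \<in> {..conn_patience M}"
      then show "fulfil_reward M u v t * fulfil (x t) c (u, v, \<xi>) \<le> fulfil_reward M u v t"
        using le_1[of c "(u, v, \<xi>)"] fulfil_reward_nonneg[OF _ _ t, of u v]
        by (intro mult_left_le) (auto simp: trip_statuses_def)
    qed
    moreover have "(\<Sum>u\<in>regions M. \<Sum>v\<in>regions M. \<Sum>\<eta>\<le>max_task M u. \<Sum>b\<le>range_max M.
        reposition_reward M u v t * reposition (x t) (u, \<eta>, b) v) \<le> 0"
      by (intro sum_nonpos mult_nonpos_nonneg reposition_reward_nonpos nonneg(3) t)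
        (simp_all add: vehicle_statuses_def)
    moreover have "(\<Sum>c\<in>vehicle_statuses M. \<Sum>\<delta>\<in>rates M. charge_reward M \<delta> t * charge (x t) c \<delta>) \<le> 0"
      by (intro sum_nonpos mult_nonpos_nonneg charge_reward_nonpos nonneg(4) t)
    ultimately show ?thesis unfolding reward_def by linarith
  qed
  then show "fluid_objective M x \<le> real (fleet M) * (\<Sum>t=1..horizon M. ?B t)"
    unfolding fluid_objective_def by (intro mult_left_mono sum_mono) auto
qed

lemma average_reward_le_fluid_value:
  assumes \<pi>: "\<pi> \<in> policies M" and s: "s \<in> states M"
  shows "average_reward M \<pi> s \<le> fluid_value M"
proof -
  interpret robotaxi_policy M \<pi> by unfold_locales (rule \<pi>)
  obtain \<mu> where "\<And>s. s \<in> states M \<Longrightarrow> 0 \<le> \<mu> s" "(\<Sum>s\<in>states M. \<mu> s) = 1"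
    "\<And>f. (\<Sum>s\<in>states M. \<mu> s * step f s) = (\<Sum>s\<in>states M. \<mu> s * f s)"
    and lim: "\<And>f. (\<lambda>n. cesaro n f s) \<longlonglongrightarrow> (\<Sum>s\<in>states M. \<mu> s * f s)"
    using exists_limiting_occupation[OF s] by blast
  then interpret occupation M \<pi> \<mu> by unfold_locales
  have "average_reward M \<pi> s = fluid_objective M fluid"
    unfolding fluid_objective_fluid by (rule average_reward_eq[OF s lim])
  also have "\<dots> \<le> fluid_value M"
    unfolding fluid_value_def by (rule cSUP_upper[OF fluid_in_fluid_feasible fluid_objective_bdd_above])
  finally show ?thesis .
qed

text \<open>A bound on the supremum in \<open>optimal_reward\<close> follows from bounds on its
  members only over a nonempty set. Letting every vehicle pass is feasible in each state.\<close>

lemma policies_nonempty: "policies M \<noteq> {}"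
proof -
  have "(\<lambda>s. return_pmf \<lparr>fulfil = \<lambda>_ _. 0, reposition = \<lambda>_ _. 0, charge = \<lambda>_ _. 0, pass = vehicles s\<rparr>)
      \<in> policies M"
    by (simp add: policies_def pass_all_action)
  then show ?thesis by blast
qed

end

theorem theorem1:
  fixes M :: "'v taxi_params"
  assumes "robotaxi M"
  shows "\<forall>s\<in>states M. optimal_reward M s \<le> fluid_value M"
proof
  interpret robotaxi M by (rule assms)
  fix s assume "s \<in> states M"
  then show "optimal_reward M s \<le> fluid_value M"
    unfolding optimal_reward_def
    by (intro cSUP_least policies_nonempty average_reward_le_fluid_value)
qed

end
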